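(* Let $w$ be a non-trivial weight on $[0,1]$ with associated sequence $(w_r)_{r\ge1}$ (defined in the context). Let $X$ be a $w$-decomposable symmetric space on $[0,1]$ with fundamental function $\varphi$. Then there exist $C>0$ and $p\in[1,\infty]$ such that for every sequence of reals $(\tau_r)_{r=1}^\infty$ with $0<\tau_r\le w_r$ for all $r\in\mathbb N$, $$C^{-1}\varphi\Big(\sum_{r=1}^\infty\tau_r\Big)\le\Big(\sum_{r=1}^\infty\varphi(\tau_r)^p\Big)^{1/p}\le C\,\varphi\Big(\sum_{r=1}^\infty\tau_r\Big),$$ where for $p=\infty$ the middle expression is replaced by $\sup_r\varphi(\tau_r)$.
   Context: Functions are identified if they agree a.e.; $m$ is Lebesgue measure; sets such as $\operatorname{supp}x$, and infima/suprema of $w$ over such sets, are understood up to null sets. A symmetric space on $[0,1]$ is a Banach space $X\neq\{0\}$ of (classes of) measurable real functions on $[0,1]$ such that (i) $|x|\le|y|$ a.e. with $y\in X$, $x$ measurable, implies $x\in X$, $\|x\|_X\le\|y\|_X$; (ii) if $x\in X$ and $y$ is measurable with $m\{|y|>\lambda\}=m\{|x|>\lambda\}$ for all $\lambda\ge0$, then $y\in X$ and $\|y\|_X=\|x\|_X$. Its fundamental function is $\varphi(t)=\|\chi_{[0,t]}\|_X$, $t\in[0,1]$. A weight on $[0,1]$ is a measurable function that is positive and finite a.e.; it is non-trivial if $w$ or $1/w$ is unbounded. $X$ is $w$-decomposable if there is $C>0$ such that for every $n\in\mathbb N$ and all nonzero $x_1,\dots,x_n,y_1,\dots,y_n\in X$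 with $\|x_i\|_X=\|y_i\|_X$ ($1\le i\le n$) and $\inf w(\operatorname{supp}x_i\cup\operatorname{supp}y_i)\ge 2\sup w(\operatorname{supp}x_{i+1}\cup\operatorname{supp}y_{i+1})$ ($1\le i\le n-1$), one has $C^{-1}\|\sum_{i=1}^n x_i\|_X\le\|\sum_{i=1}^n y_i\|_X\le C\|\sum_{i=1}^n x_i\|_X$. For the weight $w$ put $M_k=\{t\in[0,1]: w(t)\in[2^k,2^{k+1})\}$, $k\in\mathbb Z$; $(w_r)_{r=1}^\infty$ is the non-increasing rearrangement of $(m(M_k))_{k\in\mathbb Z}$ (all $w_r>0$ because $w$ is non-trivial, and $\sum_r w_r=1$). *)

theory Defs
  imports "HOL-Probability.Essential_Supremum"
begin

abbreviation leb01 :: "real measure" where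
  "leb01 \<equiv> lebesgue_on {0..1}"

text \<open>
  A space of classes of functions on the unit interval modulo a.e. equality is represented by the
  set \<open>X\<close> of all representatives (values outside the unit interval are irrelevant), and its norm by
  a seminorm \<open>N\<close> on representatives vanishing exactly on the functions that are zero a.e.
  The values of \<open>N\<close> outside \<open>X\<close> are irrelevant.  Invariance of \<open>X\<close> and \<open>N\<close> under a.e. equality
  is a consequence of assumption \<open>ideal\<close>.
\<close>

locale symmetric_space =
  fixes X :: "(real \<Rightarrow> real) set" and N :: "(real \<Rightarrow> real) \<Rightarrow> real"
  assumes measurable: "X \<subseteq> borel_measurable leb01"
    and nontrivial: "\<exists>x\<in>X. \<not> (AE t in leb01. x t = 0)"
    and zero_mem: "(\<lambda>t. 0) \<in> X"
    and add_mem: "x \<in> X \<Longrightarrow> y \<in> X \<Longrightarrow> (\<lambda>t. x t + y t) \<in> X"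
    and scale_mem: "x \<in> X \<Longrightarrow> (\<lambda>t. c * x t) \<in> X"
    and norm_nonneg: "x \<in> X \<Longrightarrow> 0 \<le> N x"
    and norm_eq_0_iff: "x \<in> X \<Longrightarrow> N x = 0 \<longleftrightarrow> (AE t in leb01. x t = 0)"
    and norm_triangle: "x \<in> X \<Longrightarrow> y \<in> X \<Longrightarrow> N (\<lambda>t. x t + y t) \<le> N x + N y"
    and norm_scale: "x \<in> X \<Longrightarrow> N (\<lambda>t. c * x t) = \<bar>c\<bar> * N x"
    and complete:
      "(\<And>n. f n \<in> X) \<Longrightarrow>
       (\<And>e. e > 0 \<Longrightarrow> \<exists>K. \<forall>m\<ge>K. \<forall>n\<ge>K. N (\<lambda>t. f m t - f n t) < e) \<Longrightarrow>
       \<exists>g\<in>X. (\<lambda>n. N (\<lambda>t. f n t - g t)) \<longlonglongrightarrow> 0"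
    and ideal:
      "y \<in> X \<Longrightarrow> x \<in> borel_measurable leb01 \<Longrightarrow> (AE t in leb01. \<bar>x t\<bar> \<le> \<bar>y t\<bar>) \<Longrightarrow>
       x \<in> X \<and> N x \<le> N y"
    and rearrangement_invariant:
      "x \<in> X \<Longrightarrow> y \<in> borel_measurable leb01 \<Longrightarrow>
       (\<And>l. l \<ge> 0 \<Longrightarrow> measure leb01 {t\<in>{0..1}. \<bar>y t\<bar> > l} = measure leb01 {t\<in>{0..1}. \<bar>x t\<bar> > l}) \<Longrightarrow>
       y \<in> X \<and> N y = N x"

definition fundamental_function :: "((real \<Rightarrow> real) \<Rightarrow> real) \<Rightarrow> real \<Rightarrow> real" where
  "fundamental_function N t = N (indicator {0..t})"

definition weight :: "(real \<Rightarrow> real) \<Rightarrow> bool" where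
  "weight w \<longleftrightarrow> w \<in> borel_measurable leb01 \<and> (AE t in leb01. 0 < w t)"

definition nontrivial_weight :: "(real \<Rightarrow> real) \<Rightarrow> bool" where
  "nontrivial_weight w \<longleftrightarrow> weight w \<and>
     ((\<nexists>B. AE t in leb01. w t \<le> B) \<or> (\<nexists>B. AE t in leb01. 1 / w t \<le> B))"

definition supp :: "(real \<Rightarrow> real) \<Rightarrow> real set" where
  "supp x = {t\<in>{0..1}. x t \<noteq> 0}"

definition esssup_on :: "real set \<Rightarrow> (real \<Rightarrow> real) \<Rightarrow> ereal" where
  "esssup_on A w = esssup (lebesgue_on A) (\<lambda>t. ereal (w t))"

definition essinf_on :: "real set \<Rightarrow> (real \<Rightarrow> real) \<Rightarrow> ereal" where
  "essinf_on A w = - esssup (lebesgue_on A) (\<lambda>t. - ereal (w t))"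

definition decomposable ::
  "(real \<Rightarrow> real) \<Rightarrow> (real \<Rightarrow> real) set \<Rightarrow> ((real \<Rightarrow> real) \<Rightarrow> real) \<Rightarrow> bool" where
  "decomposable w X N \<longleftrightarrow>
     (\<exists>C>0. \<forall>n::nat. \<forall>x y :: nat \<Rightarrow> real \<Rightarrow> real.
        (\<forall>i\<in>{1..n}. x i \<in> X \<and> y i \<in> X \<and>
           \<not> (AE t in leb01. x i t = 0) \<and> \<not> (AE t in leb01. y i t = 0) \<and> N (x i) = N (y i)) \<longrightarrow>
        (\<forall>i\<in>{1..<n}. essinf_on (supp (x i) \<union> supp (y i)) w
           \<ge> 2 * esssup_on (supp (x (Suc i)) \<union> supp (y (Suc i))) w) \<longrightarrow>
        inverse C * N (\<lambda>t. \<Sum>i=1..n. x i t) \<le> N (\<lambda>t. \<Sum>i=1..n. y i t) \<and>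
        N (\<lambda>t. \<Sum>i=1..n. y i t) \<le> C * N (\<lambda>t. \<Sum>i=1..n. x i t))"

definition level_set :: "(real \<Rightarrow> real) \<Rightarrow> int \<Rightarrow> real set" where
  "level_set w k = {t\<in>{0..1}. 2 powi k \<le> w t \<and> w t < 2 powi (k + 1)}"

text \<open>
  Non-increasing rearrangement of a family of nonnegative reals, indexed from 0.
  The finiteness condition is needed since the cardinality of an infinite set is 0.
\<close>

definition decreasing_rearrangement :: "('i \<Rightarrow> real) \<Rightarrow> nat \<Rightarrow> real" where
  "decreasing_rearrangement a r = Inf {l. 0 \<le> l \<and> finite {k. a k > l} \<and> card {k. a k > l} \<le> r}"

text \<open>The term of index \<open>r\<close> is \<open>w\<^bsub>r+1\<^esub>\<close> in the notation with sequences indexed from 1.\<close>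

definition weight_seq :: "(real \<Rightarrow> real) \<Rightarrow> nat \<Rightarrow> real" where
  "weight_seq w = decreasing_rearrangement (\<lambda>k::int. measure lebesgue (level_set w k))"

definition lp_norm :: "ereal \<Rightarrow> (nat \<Rightarrow> real) \<Rightarrow> ereal" where
  "lp_norm p a =
     (if p = \<infinity> then (SUP r. ereal \<bar>a r\<bar>)
      else let q = real_of_ereal p in
        if summable (\<lambda>r. \<bar>a r\<bar> powr q) then ereal ((\<Sum>r. \<bar>a r\<bar> powr q) powr (1 / q)) else \<infinity>)"

end

theory Submission
  imports Defs
begin

text \<open>
  For lengths \<open>\<tau> r\<close>, \<open>\<sigma> r\<close> bounded by \<open>w r\<close>, place disjoint sets of measure \<open>\<tau> r\<close> and of
  measure \<open>\<sigma> r\<close> in the \<open>r\<close>-th largest level set of the weight. Decomposability, applied separately to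
  the level sets of even and of odd index, and rearrangement invariance show that
  \<open>\<phi> (\<tau> r) \<le> c * \<phi> (\<sigma> r)\<close> for all \<open>r < n\<close> implies
  \<open>\<phi> (\<Sum>r<n. \<tau> r) \<le> K * c * \<phi> (\<Sum>r<n. \<sigma> r)\<close>.

  Hence \<open>\<phi> (n * s) / \<phi> s\<close> is, up to a constant, independent of small \<open>s\<close>. As a function of \<open>n\<close> it
  is almost multiplicative and almost monotone, so it is equivalent to \<open>n powr \<theta>\<close> for some
  \<open>\<theta>\<close> between 0 and 1, and \<open>p = 1 / \<theta>\<close> (infinite if \<open>\<theta> = 0\<close>) is the exponent sought. Comparing arbitrary lengths with
  multiples of one tiny length gives the estimate for finite sums. It passes to infinite
  sums because \<open>\<phi> t \<le> 2 * \<phi> (t / 2)\<close>.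
\<close>

section \<open>Almost multiplicative functions\<close>

text \<open>With \<open>g = ln f\<close> and \<open>a = ln A\<close>, the hypotheses say that
  \<open>g\<close> turns products into sums and is monotone, up to the error \<open>a\<close>. Along
  powers \<open>n ^ j\<close> the error grows only linearly in \<open>j\<close>. Hence the lower
  slope \<open>(g n - a) / ln n\<close> of any base is at most the upper slope
  \<open>(g m + a) / ln m\<close> of any other, and one number separates all of them.\<close>

lemma approx_multiplicative_power:
  fixes f :: "nat \<Rightarrow> real"
  assumes f1: "f 1 = 1"
    and pos: "\<And>n. 1 \<le> n \<Longrightarrow> 0 < f n"
    and le_self: "\<And>n. 1 \<le> n \<Longrightarrow> f n \<le> real n"
    and submult: "\<And>m n. 1 \<le> m \<Longrightarrow> 1 \<le> n \<Longrightarrow> f (m * n) \<le> A * f m * f n"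
    and supermult: "\<And>m n. 1 \<le> m \<Longrightarrow> 1 \<le> n \<Longrightarrow> f m * f n \<le> A * f (m * n)"
    and almost_mono: "\<And>m n. 1 \<le> m \<Longrightarrow> m \<le> n \<Longrightarrow> f m \<le> A * f n"
  obtains \<theta> where "0 \<le> \<theta>" "\<theta> \<le> 1"
    "\<And>n. 1 \<le> n \<Longrightarrow> f n \<le> A * real n powr \<theta>" "\<And>n. 1 \<le> n \<Longrightarrow> real n powr \<theta> \<le> A * f n"
proof -
  have A1: "1 \<le> A" using almost_mono[of 1 1] f1 by simp
  define a where "a = ln A"
  define g where "g n = ln (f n)" for n
  have a0: "0 \<le> a" using A1 by (simp add: a_def)
  have g1: "g 1 = 0" using f1 by (simp add: g_def)
  have g_le: "g n \<le> ln (real n)" if "1 \<le> n" for n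
    using le_self[OF that] pos[OF that] that by (simp add: g_def)
  have g_sub: "g (m * n) \<le> a + g m + g n" if "1 \<le> m" "1 \<le> n" for m n
  proof -
    have "ln (f (m * n)) \<le> ln (A * f m * f n)"
      using submult[OF that] pos[of "m * n"] that A1 by simp
    then show ?thesis using pos[of m] pos[of n] that A1 by (simp add: g_def a_def ln_mult)
  qed
  have g_super: "g m + g n \<le> a + g (m * n)" if "1 \<le> m" "1 \<le> n" for m n
  proof -
    have "ln (f m * f n) \<le> ln (A * f (m * n))"
      using supermult[OF that] pos[of m] pos[of n] that
      by (intro ln_mono) (auto intro: mult_pos_pos)
    then show ?thesis using pos[of m] pos[of n] pos[of "m * n"] that A1
      by (simp add: g_def a_def ln_mult)
  qed
  have g_mono: "g m \<le> a + g n" if "1 \<le> m" "m \<le> n" for m n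
  proof -
    have "ln (f m) \<le> ln (A * f n)" using almost_mono[OF that] pos[of m] that by simp
    then show ?thesis using pos[of n] that A1 by (simp add: g_def a_def ln_mult)
  qed
  \<comment> \<open>Each further factor \<open>n\<close> costs one error \<open>a\<close>, so the
    error can be charged to the slope: \<open>g n - a\<close> per factor from below,
    \<open>g n + a\<close> from above.\<close>
  have g_pow_ge: "real j * (g n - a) \<le> g (n ^ j)" if "1 \<le> n" for n j
  proof (induction j)
    case (Suc j)
    have "g n + g (n ^ j) \<le> a + g (n * n ^ j)" using that by (intro g_super) auto
    then show ?case using Suc by (simp add: algebra_simps)
  qed (use g1 in simp)
  have g_pow_le: "g (n ^ j) \<le> real j * (g n + a)" if "1 \<le> n" for n j
  proof (induction j)
    case (Suc j)
    have "g (n * n ^ j) \<le> a + g n + g (n ^ j)" using that by (intro g_sub) auto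
    then show ?case using Suc by (simp add: algebra_simps)
  qed (use g1 in simp)
  have g_a_nonneg: "0 \<le> g n + a" if "1 \<le> n" for n using g_mono[of 1 n] that g1 by simp
  \<comment> \<open>Squeezing \<open>n ^ j\<close> between consecutive powers of \<open>m\<close> and letting \<open>j\<close> grow; any number
    between the two sides then serves as the exponent.\<close>
  have key: "(g n - a) / ln n \<le> (g m + a) / ln m" if "2 \<le> n" "2 \<le> m" for m n :: nat
  proof -
    define q where "q = ln n / ln m"
    have lnm: "0 < ln (real m)" and lnn: "0 < ln (real n)" using that by auto
    have q0: "0 < q" using lnm lnn by (simp add: q_def)
    have step: "real j * ((g n - a) - q * (g m + a)) \<le> g m + 2 * a" for j :: nat
    proof -
      \<comment> \<open>\<open>q\<close> is chosen so that \<open>m\<close> to the power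
        \<open>j * q\<close> equals \<open>n ^ j\<close>. Rounding the exponent up adds at most one
        factor \<open>m\<close>, whose cost \<open>g m + a\<close> does not depend on
        \<open>j\<close>.\<close>
      define i where "i = nat \<lceil>j * q\<rceil>"
      have i_ge: "j * q \<le> real i" and i_le: "real i \<le> j * q + 1"
        using q0 by (simp_all add: i_def)
      have "ln (real n ^ j) \<le> ln (real m ^ i)"
        using i_ge lnm that by (simp add: ln_realpow q_def field_simps)
      then have "real n ^ j \<le> real m ^ i" using that by simp
      then have "n ^ j \<le> m ^ i" by (metis of_nat_le_iff of_nat_power)
      then have "g (n ^ j) \<le> a + g (m ^ i)" using that by (intro g_mono) auto
      moreover have "g (m ^ i) \<le> real i * (g m + a)" using that by (intro g_pow_le) auto
      moreover have "real i * (g m + a) \<le> (j * q + 1) * (g m + a)"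
        using that by (intro mult_right_mono i_le g_a_nonneg) auto
      moreover have "real j * (g n - a) \<le> g (n ^ j)" using that by (intro g_pow_ge) auto
      ultimately show ?thesis by (simp add: algebra_simps)
    qed
    have "(g n - a) - q * (g m + a) \<le> 0"
    proof (rule ccontr)
      assume "\<not> ?thesis"
      then have "0 < (g n - a) - q * (g m + a)" by simp
      then obtain j :: nat where "g m + 2 * a < real j * ((g n - a) - q * (g m + a))"
        using reals_Archimedean3 by blast
      with step[of j] show False by simp
    qed
    then show ?thesis using lnm lnn by (simp add: q_def field_simps)
  qed
  define L where "L = (SUP n\<in>{2..}. (g n - a) / ln (real n))"
  \<comment> \<open>The maximum makes nonnegativity of \<open>\<theta>\<close> immediate; the upper
    estimates of \<open>L\<close> survive it because \<open>g m + a\<close> is nonnegative.\<close>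
  define \<theta> where "\<theta> = max 0 L"
  have bdd: "bdd_above ((\<lambda>n. (g n - a) / ln (real n)) ` {2..})"
    using key[of _ 2] by (intro bdd_aboveI[of _ "(g 2 + a) / ln (real 2)"]) auto
  have L_ge: "(g n - a) / ln n \<le> L" if "2 \<le> n" for n
    unfolding L_def using that by (intro cSUP_upper bdd) auto
  have L_le: "L \<le> (g m + a) / ln m" if "2 \<le> m" for m
    unfolding L_def using that key by (intro cSUP_least) auto
  have "L \<le> 1" unfolding L_def
  proof (intro cSUP_least)
    fix n :: nat assume "n \<in> {2..}"
    then show "(g n - a) / ln (real n) \<le> 1" using g_le[of n] a0 by (simp add: field_simps)
  qed simp
  then have \<theta>: "0 \<le> \<theta>" "\<theta> \<le> 1" by (auto simp: \<theta>_def)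
  have bounds: "g n \<le> a + \<theta> * ln n \<and> \<theta> * ln n \<le> a + g n" if "1 \<le> n" for n
  proof (cases "n = 1")
    case True then show ?thesis using g1 a0 by simp
  next
    case False
    then have n: "2 \<le> n" "0 < ln (real n)" using that by auto
    have "(g n - a) / ln n \<le> \<theta>" using L_ge[OF n(1)] by (simp add: \<theta>_def)
    moreover have "\<theta> \<le> (g n + a) / ln n"
      using L_le[OF n(1)] g_a_nonneg[OF that] n by (simp add: \<theta>_def)
    ultimately show ?thesis using n(2) by (simp add: field_simps)
  qed
  show ?thesis
  proof (rule that[OF \<theta>])
    fix n :: nat assume n: "1 \<le> n"
    have eA: "exp a = A" using A1 by (simp add: a_def)
    have eg: "exp (g n) = f n" using pos[OF n] by (simp add: g_def)
    have et: "exp (\<theta> * ln n) = real n powr \<theta>" using n by (simp add: powr_def)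
    have "exp (g n) \<le> exp (a + \<theta> * ln n)" using bounds[OF n] by simp
    then show "f n \<le> A * real n powr \<theta>" by (simp only: exp_add eA eg et)
    have "exp (\<theta> * ln n) \<le> exp (a + g n)" using bounds[OF n] by simp
    then show "real n powr \<theta> \<le> A * f n" by (simp only: exp_add eA eg et)
  qed
qed

section \<open>Functions comparable across levels\<close>

text \<open>
  Everything the argument needs to know about the space: assumption \<open>compare\<close> is what
  decomposability says about indicator functions living on different level sets of the weight.
\<close>

locale level_comparable =
  fixes \<phi> :: "real \<Rightarrow> real" and w :: "nat \<Rightarrow> real" and K :: real
  assumes phi_pos: "\<And>t. 0 < t \<Longrightarrow> t \<le> 1 \<Longrightarrow> 0 < \<phi> t"
    and phi_mono: "\<And>s t. 0 < s \<Longrightarrow> s \<le> t \<Longrightarrow> t \<le> 1 \<Longrightarrow> \<phi> s \<le> \<phi> t"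
    and phi_subadd: "\<And>s t. 0 < s \<Longrightarrow> 0 < t \<Longrightarrow> s + t \<le> 1 \<Longrightarrow> \<phi> (s + t) \<le> \<phi> s + \<phi> t"
    and w_pos: "\<And>r. 0 < w r"
    and w_antimono: "\<And>r r'. r \<le> r' \<Longrightarrow> w r' \<le> w r"
    and w_sum: "\<And>n. (\<Sum>r<n. w r) \<le> 1"
    and compare: "\<And>n \<tau> \<sigma> c. 0 < n \<Longrightarrow>
      (\<And>r. r < n \<Longrightarrow> 0 < \<tau> r \<and> \<tau> r \<le> w r) \<Longrightarrow> (\<And>r. r < n \<Longrightarrow> 0 < \<sigma> r \<and> \<sigma> r \<le> w r) \<Longrightarrow>
      (\<And>r. r < n \<Longrightarrow> \<phi> (\<tau> r) \<le> c * \<phi> (\<sigma> r)) \<Longrightarrow>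
      \<phi> (\<Sum>r<n. \<tau> r) \<le> K * c * \<phi> (\<Sum>r<n. \<sigma> r)"
begin

lemma w_le_1: "w r \<le> 1"
proof -
  have "w r \<le> (\<Sum>i<Suc r. w i)"
    using w_pos by (intro member_le_sum) (auto intro: less_imp_le)
  with w_sum[of "Suc r"] show ?thesis by simp
qed

lemma sum_le_1:
  assumes "\<And>r. r < n \<Longrightarrow> \<tau> r \<le> w r" shows "(\<Sum>r<n. \<tau> r) \<le> 1"
proof -
  have "(\<Sum>r<n. \<tau> r) \<le> (\<Sum>r<n. w r)" using assms by (intro sum_mono) auto
  with w_sum[of n] show ?thesis by simp
qed

lemma K_ge_1: "1 \<le> K"
proof -
  have "\<phi> (w 0) \<le> K * \<phi> (w 0)"
    using compare[of 1 w w 1] w_pos by simp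
  moreover have "0 < \<phi> (w 0)" using phi_pos w_pos w_le_1 by blast
  ultimately show ?thesis by simp
qed

text \<open>Since \<open>w\<close> is non-increasing, \<open>s \<le> w (n - 1)\<close> means that a
  piece of length \<open>s\<close> fits into each of the first \<open>n\<close> levels. This is the
  smallness condition on \<open>s\<close> in the growth estimates below.\<close>

lemma copies_le_1: "1 \<le> n \<Longrightarrow> s \<le> w (n - 1) \<Longrightarrow> real n * s \<le> 1"
proof -
  assume n: "1 \<le> n" and s: "s \<le> w (n - 1)"
  have "s \<le> w r" if "r < n" for r
    by (rule order_trans[OF s w_antimono]) (use that in simp)
  then have "(\<Sum>r<n. s) \<le> 1" by (rule sum_le_1)
  then show ?thesis by simp
qed

text \<open>Apply \<open>compare\<close> to \<open>n\<close> equal pieces, with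
  \<open>c = \<phi> s / \<phi> s'\<close>.\<close>

lemma compare_copies:
  assumes "1 \<le> n" "0 < s" "s \<le> w (n - 1)" "0 < s'" "s' \<le> w (n - 1)"
  shows "\<phi> (n * s) / \<phi> s \<le> K * (\<phi> (n * s') / \<phi> s')"
proof -
  have le_w: "r < n \<Longrightarrow> w (n - 1) \<le> w r" for r using w_antimono by simp
  have le1: "s \<le> 1" "s' \<le> 1" using assms w_le_1 order_trans by blast+
  have p: "0 < \<phi> s" "0 < \<phi> s'" using phi_pos assms le1 by auto
  have "\<phi> (\<Sum>r<n. s) \<le> K * (\<phi> s / \<phi> s') * \<phi> (\<Sum>r<n. s')"
    using assms le_w p by (intro compare) (auto intro: order_trans)
  then show ?thesis using p by (simp add: field_simps)
qed

lemma phi_copies_le: "1 \<le> n \<Longrightarrow> 0 < s \<Longrightarrow> real n * s \<le> 1 \<Longrightarrow> \<phi> (n * s) \<le> n * \<phi> s"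
proof (induction n rule: nat_induct_at_least)
  case (Suc n)
  have le: "real n * s \<le> 1" using Suc.prems by (simp add: algebra_simps)
  have "\<phi> (s + n * s) \<le> \<phi> s + \<phi> (n * s)"
    using Suc by (intro phi_subadd) (auto simp: algebra_simps)
  then show ?case using Suc.IH[OF \<open>0 < s\<close> le] by (simp add: algebra_simps)
qed simp

text \<open>The ratio \<open>\<phi> (n * s) / \<phi> s\<close> hardly depends on \<open>s\<close>,
  so multiplying a length by \<open>m * n\<close> can be done in two stages; this is what makes the
  ratio almost multiplicative in the number of copies.\<close>

lemma power_growth:
  obtains \<theta> B where "0 \<le> \<theta>" "\<theta> \<le> 1" "1 \<le> B"
    "\<And>n s. 1 \<le> n \<Longrightarrow> 0 < s \<Longrightarrow> s \<le> w (n - 1) \<Longrightarrow> \<phi> (n * s) \<le> B * \<phi> s * n powr \<theta>"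
    "\<And>n s. 1 \<le> n \<Longrightarrow> 0 < s \<Longrightarrow> s \<le> w (n - 1) \<Longrightarrow> \<phi> s * n powr \<theta> \<le> B * \<phi> (n * s)"
proof -
  \<comment> \<open>Up to the factor \<open>K\<close>, \<open>f n\<close> is \<open>\<phi> (n * s) / \<phi> s\<close> for every small \<open>s\<close>, which makes \<open>f\<close>
    almost multiplicative.\<close>
  define f where "f n = \<phi> (n * w (n - 1)) / \<phi> (w (n - 1))" for n :: nat
  \<comment> \<open>Each passage between \<open>\<phi> (n * s)\<close> and
    \<open>\<phi> s * f n\<close> costs one factor \<open>K\<close>, and both product inequalities
    use three such passages.\<close>
  define A where "A = K ^ 3"
  have K0: "0 < K" using K_ge_1 by simp
  have wp: "0 < \<phi> (w r)" for r using phi_pos w_pos w_le_1 by blast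
  have le_f: "\<phi> (n * s) \<le> K * \<phi> s * f n" and f_le: "\<phi> s * f n \<le> K * \<phi> (n * s)" and s_pos: "0 < \<phi> s"
    if "1 \<le> n" "0 < s" "s \<le> w (n - 1)" for n :: nat and s :: real
  proof -
    show p: "0 < \<phi> s" using phi_pos[OF that(2)] that(3) w_le_1[of "n - 1"] by simp
    show "\<phi> (n * s) \<le> K * \<phi> s * f n"
      using compare_copies[OF that w_pos order_refl] p
      unfolding f_def[symmetric] by (simp add: pos_divide_le_eq mult_ac)
    show "\<phi> s * f n \<le> K * \<phi> (n * s)"
      using compare_copies[OF that(1) w_pos order_refl that(2,3)] p
      unfolding f_def[symmetric] by (simp add: pos_le_divide_eq mult_ac)
  qed
  have f_pos: "0 < f n" if "1 \<le> n" for n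
    using phi_pos[of "n * w (n - 1)"] copies_le_1[of n "w (n - 1)"] that w_pos[of "n - 1"] wp
    by (simp add: f_def)
  have mult: "f (m * n) \<le> A * f m * f n \<and> f m * f n \<le> A * f (m * n)" if "1 \<le> m" "1 \<le> n" for m n
  proof -
    \<comment> \<open>Small enough for \<open>m * n\<close> copies of \<open>s\<close>, for
      \<open>n\<close> copies of \<open>s\<close>, and for \<open>m\<close> copies of the longer
      piece \<open>n * s\<close>.\<close>
    define s where "s = min (w (m * n - 1)) (min (w (n - 1)) (w (m - 1) / n))"
    have s: "0 < s" "s \<le> w (m * n - 1)" "s \<le> w (n - 1)" and "s \<le> w (m - 1) / n"
      using w_pos that by (simp_all add: s_def)
    then have s4: "n * s \<le> w (m - 1)" using that by (simp add: field_simps)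
    have mn: "1 \<le> m * n" using that by simp
    have p: "0 < \<phi> s" using s_pos[OF that(2) s(1,3)] .
    have fp: "0 < f m" "0 < f n" "0 < f (m * n)" using f_pos that mn by auto
    have ns: "0 < real n * s" using s that by simp
    have assoc: "real (m * n) * s = real m * (real n * s)" by simp
    have "\<phi> s * f (m * n) \<le> K * \<phi> (m * (n * s))"
      using f_le[OF mn s(1,2)] by (simp only: assoc)
    also have "\<dots> \<le> K * (K * \<phi> (n * s) * f m)"
      using le_f[OF that(1) ns s4] K0 by simp
    also have "\<dots> \<le> K * (K * (K * \<phi> s * f n) * f m)"
      using le_f[OF that(2) s(1,3)] K0 fp by simp
    also have "\<dots> = \<phi> s * (A * f m * f n)" by (simp add: A_def power3_eq_cube)
    finally have 1: "f (m * n) \<le> A * f m * f n" using p by simp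
    have "\<phi> s * (f m * f n) = (\<phi> s * f n) * f m" by simp
    also have "\<dots> \<le> (K * \<phi> (n * s)) * f m"
      using f_le[OF that(2) s(1,3)] fp by simp
    also have "\<dots> \<le> K * (K * \<phi> (m * (n * s)))"
      using f_le[OF that(1) ns s4] K0 by simp
    also have "\<dots> \<le> K * (K * (K * \<phi> s * f (m * n)))"
      using le_f[OF mn s(1,2)] K0 by (simp only: assoc) simp
    also have "\<dots> = \<phi> s * (A * f (m * n))" by (simp add: A_def power3_eq_cube)
    finally have 2: "f m * f n \<le> A * f (m * n)" using p by simp
    from 1 2 show ?thesis by simp
  qed
  have mono: "f m \<le> A * f n" if "1 \<le> m" "m \<le> n" for m n
  proof -
    \<comment> \<open>For this length \<open>\<phi> (n * s) = \<phi> s * f n\<close> exactly, by the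
      definition of \<open>f\<close>, so only the passage for \<open>m\<close> loses a factor
      \<open>K\<close>.\<close>
    define s where "s = w (n - 1)"
    have s: "0 < s" "s \<le> w (m - 1)" "s \<le> w (n - 1)"
      using w_pos w_antimono[of "m - 1" "n - 1"] that by (auto simp: s_def)
    have n: "1 \<le> n" using that by simp
    have p: "0 < \<phi> s" using s_pos[OF that(1) s(1,2)] .
    have "\<phi> s * f m \<le> K * \<phi> (m * s)" using f_le[OF that(1) s(1,2)] .
    also have "\<dots> \<le> K * \<phi> (n * s)"
      using that s K0 copies_le_1[OF n s(3)] by (intro mult_left_mono phi_mono) auto
    also have "\<dots> = \<phi> s * (K * f n)" using p by (simp add: f_def s_def)
    finally have "f m \<le> K * f n" using p by simp
    also have "\<dots> \<le> A * f n" using K_ge_1 f_pos[OF n] by (simp add: A_def self_le_power)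
    finally show ?thesis .
  qed
  have le_self: "f n \<le> real n" if "1 \<le> n" for n
    using phi_copies_le[of n "w (n - 1)"] copies_le_1[of n "w (n - 1)"] that w_pos[of "n - 1"] wp[of "n - 1"]
    by (simp add: f_def pos_divide_le_eq)
  obtain \<theta> where \<theta>: "0 \<le> \<theta>" "\<theta> \<le> 1"
    "\<And>n. 1 \<le> n \<Longrightarrow> f n \<le> A * real n powr \<theta>" "\<And>n. 1 \<le> n \<Longrightarrow> real n powr \<theta> \<le> A * f n"
  proof (rule approx_multiplicative_power[of f A])
    show "f 1 = 1" using wp[of 0] by (simp add: f_def)
  qed (use f_pos le_self mult mono in auto)
  have A1: "1 \<le> A" using K_ge_1 by (simp add: A_def)
  show ?thesis
  proof (rule that[OF \<theta>(1,2), of "K * A"])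
    show "1 \<le> K * A" using K_ge_1 A1 mult_mono[of 1 K 1 A] by simp
    fix n :: nat and s assume ns: "1 \<le> n" "0 < s" "s \<le> w (n - 1)"
    note p = s_pos[OF ns]
    have "\<phi> (n * s) \<le> K * \<phi> s * f n" using le_f[OF ns] .
    also have "\<dots> \<le> K * \<phi> s * (A * n powr \<theta>)" using \<theta>(3)[OF ns(1)] K0 p by simp
    finally show "\<phi> (n * s) \<le> K * A * \<phi> s * n powr \<theta>" by (simp add: algebra_simps)
    have "\<phi> s * n powr \<theta> \<le> \<phi> s * (A * f n)" using \<theta>(4)[OF ns(1)] p by simp
    also have "\<dots> \<le> A * (K * \<phi> (n * s))" using f_le[OF ns] A1 by simp
    finally show "\<phi> s * n powr \<theta> \<le> K * A * \<phi> (n * s)" by (simp add: algebra_simps)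
  qed
qed

section \<open>Comparison of finite sums with an lp norm\<close>

text \<open>In both bounds, \<open>K\<close> comes from one use of \<open>compare\<close>, one
  factor \<open>B\<close> from the growth estimate for the single pieces, the other from the growth
  estimate for the whole sum, and the 2 from rounding to whole numbers of copies.\<close>

lemma lp_bounds_finite:
  assumes \<theta>: "0 < \<theta>" "\<theta> \<le> 1" and B: "1 \<le> B"
    and upper: "\<And>n s. 1 \<le> n \<Longrightarrow> 0 < s \<Longrightarrow> s \<le> w (n - 1) \<Longrightarrow> \<phi> (n * s) \<le> B * \<phi> s * n powr \<theta>"
    and lower: "\<And>n s. 1 \<le> n \<Longrightarrow> 0 < s \<Longrightarrow> s \<le> w (n - 1) \<Longrightarrow> \<phi> s * n powr \<theta> \<le> B * \<phi> (n * s)"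
    and n: "0 < n" and \<tau>: "\<And>r. r < n \<Longrightarrow> 0 < \<tau> r \<and> \<tau> r \<le> w r"
  shows "\<phi> (\<Sum>r<n. \<tau> r) \<le> 2 * K * B\<^sup>2 * (\<Sum>r<n. \<phi> (\<tau> r) powr (1 / \<theta>)) powr \<theta>"
    and "(\<Sum>r<n. \<phi> (\<tau> r) powr (1 / \<theta>)) powr \<theta> \<le> 2 * K * B\<^sup>2 * \<phi> (\<Sum>r<n. \<tau> r)"
proof -
  define p where "p = 1 / \<theta>"
  have p: "0 < p" "p * \<theta> = 1" using \<theta> by (auto simp: p_def)
  define S where "S = (\<Sum>r<n. \<phi> (\<tau> r) powr p)"
  have phi_\<tau>: "0 < \<phi> (\<tau> r)" if "r < n" for r
    using phi_pos[of "\<tau> r"] \<tau>[OF that] w_le_1[of r] by simp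
  \<comment> \<open>Replace \<open>\<tau> r\<close> by \<open>k r\<close> copies of one tiny length \<open>s\<close>, where \<open>k r\<close> is proportional to
    \<open>\<phi> (\<tau> r) powr p\<close> up to a factor 2; then \<open>\<phi> (k r * s)\<close> is proportional to \<open>\<phi> (\<tau> r)\<close>, and both
    sums can be read off from the growth of \<open>\<phi>\<close> along multiples of \<open>s\<close>.\<close>
  define T where "T = (\<Sum>r<n. 1 / \<phi> (\<tau> r))"
  \<comment> \<open>This is the purpose of \<open>T\<close>: all numbers to be rounded up are at
    least 1, so rounding at most doubles them.\<close>
  have T_ge: "1 \<le> T * \<phi> (\<tau> r)" if "r < n" for r
  proof -
    have "1 / \<phi> (\<tau> r) \<le> T"
      unfolding T_def using that phi_\<tau> by (intro member_le_sum) (auto intro: less_imp_le)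
    then show ?thesis using phi_\<tau>[OF that] by (simp add: field_simps)
  qed
  have T0: "0 < T" unfolding T_def using n phi_\<tau> by (intro sum_pos) auto
  define k where "k r = nat \<lceil>(T * \<phi> (\<tau> r)) powr p\<rceil>" for r
  have k: "1 \<le> k r" "(T * \<phi> (\<tau> r)) powr p \<le> k r" "k r \<le> 2 * (T * \<phi> (\<tau> r)) powr p" if "r < n" for r
  proof -
    have y: "1 \<le> (T * \<phi> (\<tau> r)) powr p" using T_ge[OF that] p by (simp add: ge_one_powr_ge_zero)
    show "(T * \<phi> (\<tau> r)) powr p \<le> k r" by (simp add: k_def)
    with y show "1 \<le> k r" by linarith
    have "k r \<le> (T * \<phi> (\<tau> r)) powr p + 1" using y by (simp add: k_def)
    with y show "k r \<le> 2 * (T * \<phi> (\<tau> r)) powr p" by linarith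
  qed
  define M where "M = (\<Sum>r<n. k r)"
  have k_le_M: "k r \<le> M" if "r < n" for r
    unfolding M_def using that by (intro member_le_sum) auto
  have M1: "1 \<le> M" using k_le_M[OF n] k(1)[OF n] by simp
  have powr_T: "(T * \<phi> (\<tau> r)) powr p = T powr p * \<phi> (\<tau> r) powr p" if "r < n" for r
    using T0 phi_\<tau>[OF that] by (simp add: powr_mult)
  have M_ge: "T powr p * S \<le> M"
    unfolding M_def S_def of_nat_sum sum_distrib_left
    using k(2) powr_T by (intro sum_mono) auto
  have M_le: "M \<le> 2 * (T powr p * S)"
    unfolding M_def S_def of_nat_sum sum_distrib_left
    using k(3) powr_T by (intro sum_mono) auto
  have S0: "0 < S" 
  proof -
    have "0 < \<phi> (\<tau> r) powr p" if "r < n" for r using phi_\<tau>[OF that] by simp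
    then show ?thesis unfolding S_def using n by (intro sum_pos) auto
  qed
  have two: "2 powr \<theta> \<le> 2" using powr_mono[of \<theta> 1 2] \<theta> by simp
  have TS: "(T powr p * S) powr \<theta> = T * S powr \<theta>"
    using T0 S0 p by (simp add: powr_mult powr_powr)
  have "(T powr p * S) powr \<theta> \<le> real M powr \<theta>"
    using M_ge \<theta> S0 by (intro powr_mono2) auto
  then have M_ge': "T * S powr \<theta> \<le> M powr \<theta>" by (simp only: TS)
  have "M powr \<theta> \<le> (2 * (T powr p * S)) powr \<theta>"
    using M_le \<theta> by (intro powr_mono2) auto
  also have "\<dots> = 2 powr \<theta> * (T * S powr \<theta>)" by (simp add: powr_mult TS[symmetric])
  also have "\<dots> \<le> 2 * (T * S powr \<theta>)" using two T0 by (intro mult_right_mono) auto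
  finally have M_le': "M powr \<theta> \<le> 2 * (T * S powr \<theta>)" .
  have k_ge': "T * \<phi> (\<tau> r) \<le> k r powr \<theta>" and k_le': "k r powr \<theta> \<le> 2 * (T * \<phi> (\<tau> r))"
    if "r < n" for r
  proof -
    have pos: "0 < T * \<phi> (\<tau> r)" using T0 phi_\<tau>[OF that] by simp
    have "((T * \<phi> (\<tau> r)) powr p) powr \<theta> \<le> k r powr \<theta>"
      using k(2)[OF that] \<theta> by (intro powr_mono2) auto
    then show "T * \<phi> (\<tau> r) \<le> k r powr \<theta>" using pos p by (simp add: powr_powr)
    have "k r powr \<theta> \<le> (2 * (T * \<phi> (\<tau> r)) powr p) powr \<theta>"
      using k(3)[OF that] \<theta> by (intro powr_mono2) auto
    also have "\<dots> = 2 powr \<theta> * (T * \<phi> (\<tau> r))"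
      using pos p by (simp add: powr_mult[of 2] powr_powr)
    also have "\<dots> \<le> 2 * (T * \<phi> (\<tau> r))" using two pos by (intro mult_right_mono) auto
    finally show "k r powr \<theta> \<le> 2 * (T * \<phi> (\<tau> r))" .
  qed
  \<comment> \<open>The first bound admits the growth estimates for \<open>M\<close> copies and for
    every \<open>k r \<le> M\<close>. The second makes all \<open>M\<close> copies together fit
    below \<open>w (n - 1)\<close>, hence each \<open>\<sigma> r\<close> below
    \<open>w r\<close>.\<close>
  define s where "s = min (w (M - 1)) (w (n - 1) / M)"
  have s: "0 < s" "s \<le> w (M - 1)" and "s \<le> w (n - 1) / M"
    using w_pos M1 by (simp_all add: s_def)
  then have Ms: "M * s \<le> w (n - 1)" using M1 by (simp add: field_simps)
  have phi_s: "0 < \<phi> s" using phi_pos[of s] s w_le_1[of "M - 1"] by simp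
  have s_le: "s \<le> w (k r - 1)" if "r < n" for r
    using s(2) w_antimono[of "k r - 1" "M - 1"] k_le_M[OF that] by (simp add: diff_le_mono)
  define \<sigma> where "\<sigma> r = k r * s" for r
  have \<sigma>: "0 < \<sigma> r \<and> \<sigma> r \<le> w r" if "r < n" for r
  proof
    show "0 < \<sigma> r" using k(1)[OF that] s by (simp add: \<sigma>_def)
    have "\<sigma> r \<le> M * s" using k_le_M[OF that] s by (simp add: \<sigma>_def)
    also note Ms
    also have "w (n - 1) \<le> w r" using that by (intro w_antimono) simp
    finally show "\<sigma> r \<le> w r" .
  qed
  have sum_\<sigma>: "(\<Sum>r<n. \<sigma> r) = M * s" by (simp add: \<sigma>_def M_def sum_distrib_right)
  have K0: "0 < K" using K_ge_1 by simp
  \<comment> \<open>The constant is read off from \<open>\<phi> (\<sigma> r)\<close>, which is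
    comparable to \<open>\<phi> s * k r powr \<theta>\<close> and thus to
    \<open>T * \<phi> s * \<phi> (\<tau> r)\<close>.\<close>
  have "\<phi> (\<Sum>r<n. \<tau> r) \<le> K * (B / (T * \<phi> s)) * \<phi> (\<Sum>r<n. \<sigma> r)"
  proof (rule compare[OF n \<tau> \<sigma>])
    fix r assume r: "r < n"
    have "\<phi> s * (T * \<phi> (\<tau> r)) \<le> \<phi> s * k r powr \<theta>" using k_ge'[OF r] phi_s by simp
    also have "\<dots> \<le> B * \<phi> (\<sigma> r)" unfolding \<sigma>_def using k(1)[OF r] s(1) s_le[OF r] by (rule lower)
    finally show "\<phi> (\<tau> r) \<le> B / (T * \<phi> s) * \<phi> (\<sigma> r)" using T0 phi_s by (simp add: field_simps)
  qed
  also have "\<dots> \<le> K * (B / (T * \<phi> s)) * (B * \<phi> s * M powr \<theta>)"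
    unfolding sum_\<sigma> using K0 B T0 phi_s by (intro mult_left_mono upper[OF M1 s]) auto
  also have "\<dots> = K * B\<^sup>2 / T * M powr \<theta>" using phi_s by (simp add: power2_eq_square)
  also have "\<dots> \<le> K * B\<^sup>2 / T * (2 * (T * S powr \<theta>))"
    using K0 T0 by (intro mult_left_mono M_le') auto
  also have "\<dots> = 2 * K * B\<^sup>2 * S powr \<theta>" using T0 by simp
  finally show "\<phi> (\<Sum>r<n. \<tau> r) \<le> 2 * K * B\<^sup>2 * (\<Sum>r<n. \<phi> (\<tau> r) powr (1 / \<theta>)) powr \<theta>"
    by (simp add: S_def p_def)
  have "\<phi> (\<Sum>r<n. \<sigma> r) \<le> K * (2 * B * T * \<phi> s) * \<phi> (\<Sum>r<n. \<tau> r)"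
  proof (rule compare[OF n \<sigma> \<tau>])
    fix r assume r: "r < n"
    have "\<phi> (\<sigma> r) \<le> B * \<phi> s * k r powr \<theta>"
      unfolding \<sigma>_def using k(1)[OF r] s(1) s_le[OF r] by (rule upper)
    also have "\<dots> \<le> B * \<phi> s * (2 * (T * \<phi> (\<tau> r)))"
      using k_le'[OF r] B phi_s by (intro mult_left_mono) auto
    finally show "\<phi> (\<sigma> r) \<le> 2 * B * T * \<phi> s * \<phi> (\<tau> r)" by (simp add: algebra_simps)
  qed
  then have *: "\<phi> (M * s) \<le> K * (2 * B * T * \<phi> s) * \<phi> (\<Sum>r<n. \<tau> r)" by (simp only: sum_\<sigma>)
  have "\<phi> s * (T * S powr \<theta>) \<le> \<phi> s * M powr \<theta>" using M_ge' phi_s by simp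
  also have "\<dots> \<le> B * \<phi> (M * s)" by (rule lower[OF M1 s])
  also have "\<dots> \<le> B * (K * (2 * B * T * \<phi> s) * \<phi> (\<Sum>r<n. \<tau> r))" using * B by simp
  also have "\<dots> = \<phi> s * (T * (2 * K * B\<^sup>2 * \<phi> (\<Sum>r<n. \<tau> r)))"
    by (simp add: power2_eq_square algebra_simps)
  finally have "S powr \<theta> \<le> 2 * K * B\<^sup>2 * \<phi> (\<Sum>r<n. \<tau> r)" using phi_s T0 by simp
  then show "(\<Sum>r<n. \<phi> (\<tau> r) powr (1 / \<theta>)) powr \<theta> \<le> 2 * K * B\<^sup>2 * \<phi> (\<Sum>r<n. \<tau> r)"
    by (simp add: S_def p_def)
qed

section \<open>Passage from finite to infinite sums\<close>

text \<open>Some partial sum exceeds half of the total, and subadditivity bounds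
  \<open>\<phi>\<close> of the total by twice \<open>\<phi>\<close> of its half. This stands in for
  continuity of \<open>\<phi>\<close>, at the price of a factor 2.\<close>

lemma sum_bounds:
  assumes "\<And>r. 0 < \<tau> r \<and> \<tau> r \<le> w r"
  shows "0 < suminf \<tau>" "suminf \<tau> \<le> 1" "\<And>n. 0 < n \<Longrightarrow> \<phi> (\<Sum>r<n. \<tau> r) \<le> \<phi> (suminf \<tau>)"
    "\<exists>n>0. \<phi> (suminf \<tau>) \<le> 2 * \<phi> (\<Sum>r<n. \<tau> r)"
proof -
  have le1: "(\<Sum>r<n. \<tau> r) \<le> 1" for n using assms by (intro sum_le_1) auto
  have sm: "summable \<tau>"
    using assms le1 by (intro summableI_nonneg_bounded[of \<tau> 1]) (auto intro: less_imp_le)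
  show pos: "0 < suminf \<tau>" using suminf_pos[OF sm] assms by auto
  show S1: "suminf \<tau> \<le> 1" using suminf_le_const[OF sm] le1 by auto
  have part_pos: "0 < (\<Sum>r<n. \<tau> r)" if "0 < n" for n
    using that assms by (intro sum_pos) auto
  have part_le: "(\<Sum>r<n. \<tau> r) \<le> suminf \<tau>" for n
    using assms by (intro sum_le_suminf sm) (auto intro: less_imp_le)
  show "\<phi> (\<Sum>r<n. \<tau> r) \<le> \<phi> (suminf \<tau>)" if "0 < n" for n
    using part_pos[OF that] part_le S1 by (rule phi_mono)
  have "eventually (\<lambda>n. suminf \<tau> / 2 < (\<Sum>r<n. \<tau> r)) sequentially"
    using summable_LIMSEQ[OF sm] pos by (intro order_tendstoD) auto
  then obtain n where n: "suminf \<tau> / 2 < (\<Sum>r<n. \<tau> r)"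
    unfolding eventually_sequentially by blast
  then have n0: "0 < n" using pos by (cases n) auto
  have "\<phi> (suminf \<tau> / 2 + suminf \<tau> / 2) \<le> \<phi> (suminf \<tau> / 2) + \<phi> (suminf \<tau> / 2)"
    using pos S1 by (intro phi_subadd) auto
  moreover have "\<phi> (suminf \<tau> / 2) \<le> \<phi> (\<Sum>r<n. \<tau> r)"
    using pos n le1 by (intro phi_mono) auto
  ultimately show "\<exists>n>0. \<phi> (suminf \<tau>) \<le> 2 * \<phi> (\<Sum>r<n. \<tau> r)"
    using n0 by (intro exI[of _ n]) simp
qed

lemma lp_norm_estimate:
  "\<exists>C::real. C > 0 \<and> (\<exists>p::ereal. 1 \<le> p \<and>
    (\<forall>\<tau>::nat \<Rightarrow> real. (\<forall>r. 0 < \<tau> r \<and> \<tau> r \<le> w r) \<longrightarrow>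
      ereal (inverse C * \<phi> (\<Sum>r. \<tau> r)) \<le> lp_norm p (\<lambda>r. \<phi> (\<tau> r)) \<and>
      lp_norm p (\<lambda>r. \<phi> (\<tau> r)) \<le> ereal (C * \<phi> (\<Sum>r. \<tau> r))))"
proof -
  obtain \<theta> B where \<theta>: "0 \<le> \<theta>" "\<theta> \<le> 1" and B: "1 \<le> B"
    and upper: "\<And>n s. 1 \<le> n \<Longrightarrow> 0 < s \<Longrightarrow> s \<le> w (n - 1) \<Longrightarrow> \<phi> (n * s) \<le> B * \<phi> s * n powr \<theta>"
    and lower: "\<And>n s. 1 \<le> n \<Longrightarrow> 0 < s \<Longrightarrow> s \<le> w (n - 1) \<Longrightarrow> \<phi> s * n powr \<theta> \<le> B * \<phi> (n * s)"
    using power_growth by metis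
  have K0: "1 \<le> K" using K_ge_1 .
  have phi_\<tau>: "0 < \<phi> (\<tau> r)" if "\<And>r. 0 < \<tau> r \<and> \<tau> r \<le> w r" for \<tau> r
    using phi_pos[of "\<tau> r"] that[of r] w_le_1[of r] by simp
  show ?thesis
  proof (cases "\<theta> = 0")
    case True
    define C where "C = 2 * K * B"
    have C1: "1 \<le> C" using K0 B mult_mono[of 1 K 1 B] by (simp add: C_def)
    have "ereal (inverse C * \<phi> (suminf \<tau>)) \<le> (SUP r. ereal \<bar>\<phi> (\<tau> r)\<bar>) \<and>
        (SUP r. ereal \<bar>\<phi> (\<tau> r)\<bar>) \<le> ereal (C * \<phi> (suminf \<tau>))"
      if \<tau>: "\<And>r. 0 < \<tau> r \<and> \<tau> r \<le> w r" for \<tau>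
    proof
      note sb = sum_bounds[OF \<tau>]
      have phi_S: "0 < \<phi> (suminf \<tau>)" using phi_pos sb by blast
      have pp: "0 < \<phi> (\<tau> r)" for r using phi_\<tau>[OF \<tau>] .
      have "\<phi> (\<tau> r) \<le> C * \<phi> (suminf \<tau>)" for r
      proof -
        have "\<tau> r \<le> (\<Sum>i<Suc r. \<tau> i)" using \<tau> by (intro member_le_sum) (auto intro: less_imp_le)
        then have "\<phi> (\<tau> r) \<le> \<phi> (\<Sum>i<Suc r. \<tau> i)"
          using \<tau> by (intro phi_mono sum_le_1) auto
        also have "\<dots> \<le> \<phi> (suminf \<tau>)" by (rule sb(3)) simp
        also have "\<dots> \<le> C * \<phi> (suminf \<tau>)" using C1 phi_S by simp
        finally show ?thesis .
      qed
      then show "(SUP r. ereal \<bar>\<phi> (\<tau> r)\<bar>) \<le> ereal (C * \<phi> (suminf \<tau>))"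
        using pp by (intro SUP_least) (simp add: less_imp_le)
      obtain n where n: "0 < n" "\<phi> (suminf \<tau>) \<le> 2 * \<phi> (\<Sum>r<n. \<tau> r)" using sb(4) by blast
      define \<mu> where "\<mu> = Max ((\<lambda>r. \<phi> (\<tau> r)) ` {..<n})"
      have \<mu>: "\<phi> (\<tau> r) \<le> \<mu>" if "r < n" for r unfolding \<mu>_def using that by (intro Max_ge) auto
      have "\<mu> \<in> (\<lambda>r. \<phi> (\<tau> r)) ` {..<n}" unfolding \<mu>_def using n by (intro Max_in) auto
      then obtain r where r: "\<mu> = \<phi> (\<tau> r)" by auto
      \<comment> \<open>Comparison with a constant sequence: as \<open>\<theta> = 0\<close>,
        \<open>upper\<close> bounds \<open>\<phi> (n * s)\<close> by \<open>B * \<phi> s\<close>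
        whatever \<open>n\<close> is, so only the largest \<open>\<phi> (\<tau> r)\<close>
        matters.\<close>
      define s where "s = w (n - 1)"
      have s: "0 < s" "s \<le> w (n - 1)" using w_pos by (auto simp: s_def)
      have phi_s: "0 < \<phi> s" using phi_pos[of s] s w_le_1[of "n - 1"] by simp
      have "\<phi> (\<Sum>r<n. \<tau> r) \<le> K * (\<mu> / \<phi> s) * \<phi> (\<Sum>r<n. s)"
      proof (rule compare[OF n(1) \<tau>])
        show "0 < s \<and> s \<le> w r" if "r < n" for r
          using s(1) w_antimono[of r "n - 1"] that by (simp add: s_def)
        show "\<phi> (\<tau> r) \<le> \<mu> / \<phi> s * \<phi> s" if "r < n" for r using \<mu>[OF that] phi_s by simp
      qed
      also have "\<dots> \<le> K * (\<mu> / \<phi> s) * (B * \<phi> s)"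
        using upper[of n s] n s True K0 phi_s pp r by (intro mult_left_mono) (auto simp: less_imp_le)
      also have "\<dots> = K * B * \<mu>" using phi_s by simp
      finally have "\<phi> (suminf \<tau>) \<le> C * \<phi> (\<tau> r)" using n(2) r by (simp add: C_def)
      then have "inverse C * \<phi> (suminf \<tau>) \<le> \<phi> (\<tau> r)" using C1 by (simp add: field_simps)
      then have "ereal (inverse C * \<phi> (suminf \<tau>)) \<le> ereal \<bar>\<phi> (\<tau> r)\<bar>" using pp[of r] by simp
      also have "\<dots> \<le> (SUP r. ereal \<bar>\<phi> (\<tau> r)\<bar>)" by (intro SUP_upper) simp
      finally show "ereal (inverse C * \<phi> (suminf \<tau>)) \<le> (SUP r. ereal \<bar>\<phi> (\<tau> r)\<bar>)" .
    qed
    then show ?thesis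
      using C1 by (intro exI[of _ C] conjI exI[of _ \<infinity>]) (auto simp: lp_norm_def)
  next
    case False
    with \<theta> have \<theta>0: "0 < \<theta>" by simp
    define p where "p = 1 / \<theta>"
    have p: "1 \<le> p" "1 / p = \<theta>" "\<theta> * p = 1" using \<theta>0 \<theta> by (auto simp: p_def)
    define D where "D = 2 * K * B\<^sup>2"
    have D1: "0 < D" using K0 B by (simp add: D_def)
    note fin = lp_bounds_finite[OF \<theta>0 \<theta>(2) B upper lower, folded p_def D_def]
    have main: "summable (\<lambda>r. \<phi> (\<tau> r) powr p) \<and>
      inverse (2 * D) * \<phi> (suminf \<tau>) \<le> (\<Sum>r. \<phi> (\<tau> r) powr p) powr \<theta> \<and>
      (\<Sum>r. \<phi> (\<tau> r) powr p) powr \<theta> \<le> 2 * D * \<phi> (suminf \<tau>)"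
      if \<tau>: "\<And>r. 0 < \<tau> r \<and> \<tau> r \<le> w r" for \<tau>
    proof -
      note sb = sum_bounds[OF \<tau>]
      have phi_S: "0 < \<phi> (suminf \<tau>)" using phi_pos sb by blast
      \<comment> \<open>A bound on the partial sums independent of \<open>n\<close> gives
        summability, which selects the finite branch of \<open>lp_norm\<close>.\<close>
      have part: "(\<Sum>r<n. \<phi> (\<tau> r) powr p) \<le> (D * \<phi> (suminf \<tau>)) powr p" for n
      proof (cases "n = 0")
        case False
        define P where "P = (\<Sum>r<n. \<phi> (\<tau> r) powr p)"
        have P0: "0 \<le> P" by (simp add: P_def sum_nonneg)
        have "P powr \<theta> \<le> D * \<phi> (\<Sum>r<n. \<tau> r)"
          unfolding P_def using False \<tau> by (intro fin) auto
        also have "\<dots> \<le> D * \<phi> (suminf \<tau>)" using sb(3)[of n] False D1 by simp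
        finally have "(P powr \<theta>) powr p \<le> (D * \<phi> (suminf \<tau>)) powr p"
          using p by (intro powr_mono2) auto
        then show ?thesis using P0 p by (simp add: powr_powr P_def)
      qed simp
      have sm: "summable (\<lambda>r. \<phi> (\<tau> r) powr p)"
        using part by (intro summableI_nonneg_bounded) auto
      define Q where "Q = (\<Sum>r. \<phi> (\<tau> r) powr p)"
      have Q0: "0 \<le> Q" unfolding Q_def by (intro suminf_nonneg sm) simp
      have "Q \<le> (D * \<phi> (suminf \<tau>)) powr p"
        unfolding Q_def using suminf_le_const[OF sm] part by auto
      then have "Q powr \<theta> \<le> ((D * \<phi> (suminf \<tau>)) powr p) powr \<theta>"
        using Q0 \<theta>0 by (intro powr_mono2) auto
      also have "\<dots> = D * \<phi> (suminf \<tau>)"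
        using p(3) D1 phi_S by (simp add: powr_powr mult.commute[of p])
      finally have 1: "Q powr \<theta> \<le> D * \<phi> (suminf \<tau>)" .
      moreover have "0 < D * \<phi> (suminf \<tau>)" using D1 phi_S by simp
      ultimately have 1: "Q powr \<theta> \<le> 2 * D * \<phi> (suminf \<tau>)" by linarith
      \<comment> \<open>The factor 2 in the final constant \<open>2 * D\<close> arises here, from
        replacing the whole series by a partial sum.\<close>
      obtain n where n: "0 < n" "\<phi> (suminf \<tau>) \<le> 2 * \<phi> (\<Sum>r<n. \<tau> r)" using sb(4) by blast
      have "\<phi> (\<Sum>r<n. \<tau> r) \<le> D * (\<Sum>r<n. \<phi> (\<tau> r) powr p) powr \<theta>"
        using n \<tau> by (intro fin) auto
      also have "\<dots> \<le> D * Q powr \<theta>"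
        unfolding Q_def using D1 \<theta>0
        by (intro mult_left_mono powr_mono2 sum_le_suminf sm) (auto simp: sum_nonneg)
      finally have "\<phi> (suminf \<tau>) \<le> 2 * D * Q powr \<theta>" using n(2) by simp
      then have "inverse (2 * D) * \<phi> (suminf \<tau>) \<le> Q powr \<theta>" using D1 by (simp add: field_simps)
      with 1 sm show ?thesis by (simp add: Q_def)
    qed
    have "ereal (inverse (2 * D) * \<phi> (suminf \<tau>)) \<le> lp_norm (ereal p) (\<lambda>r. \<phi> (\<tau> r)) \<and>
      lp_norm (ereal p) (\<lambda>r. \<phi> (\<tau> r)) \<le> ereal (2 * D * \<phi> (suminf \<tau>))"
      if \<tau>: "\<And>r. 0 < \<tau> r \<and> \<tau> r \<le> w r" for \<tau>
    proof -
      have "\<bar>\<phi> (\<tau> r)\<bar> = \<phi> (\<tau> r)" for r using phi_\<tau>[OF \<tau>, of r] by simp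
      then show ?thesis using main[OF \<tau>] by (simp add: lp_norm_def p(2) Let_def)
    qed
    then show ?thesis
      using D1 p(1) by (intro exI[of _ "2 * D"] conjI exI[of _ "ereal p"]) auto
  qed
qed

end

section \<open>Level sets of a weight\<close>

lemma lmeasurable_unit_subset:
  "E \<in> sets lebesgue \<Longrightarrow> E \<subseteq> {0..1::real} \<Longrightarrow> E \<in> lmeasurable"
  by (rule fmeasurableI2[of "{0..1}"]) (auto simp: lmeasurable_interval)

text \<open>The measure of \<open>M \<inter> {0..s}\<close> is 1-Lipschitz in \<open>s\<close> and
  runs from 0 to the measure of \<open>M\<close>, so the intermediate value theorem applies.\<close>

lemma exists_subset_of_measure:
  fixes M :: "real set"
  assumes M: "M \<in> sets lebesgue" "M \<subseteq> {0..1}" and \<tau>: "0 \<le> \<tau>" "\<tau> \<le> measure lebesgue M"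
  obtains E where "E \<subseteq> M" "E \<in> sets lebesgue" "measure lebesgue E = \<tau>"
proof -
  define f where "f s = measure lebesgue (M \<inter> {0..s})" for s
  have lm: "M \<inter> {0..s} \<in> lmeasurable" for s
    using M by (intro lmeasurable_unit_subset) auto
  have f_mono: "f s \<le> f s'" if "s \<le> s'" for s s'
    unfolding f_def using that lm M by (intro measure_mono_fmeasurable) auto
  have f_diff: "f s' \<le> f s + (s' - s)" if "s \<le> s'" for s s'
  proof -
    have "f s' \<le> measure lebesgue (M \<inter> {0..s} \<union> {s..s'})"
      unfolding f_def using lm by (intro measure_mono_fmeasurable) (auto simp: M)
    also have "\<dots> \<le> f s + measure lebesgue {s..s'}"
      unfolding f_def using lm M by (intro measure_Un_le) auto
    finally show ?thesis using that by simp
  qed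
  have "1-lipschitz_on {0..1} f"
  proof (rule lipschitz_on_leI)
    fix s s' :: real assume "s \<le> s'"
    then show "dist (f s) (f s') \<le> 1 * dist s s'"
      using f_mono[of s s'] f_diff[of s s'] by (simp add: dist_real_def)
  qed simp
  then have "continuous_on {0..1} f" by (rule lipschitz_on_continuous_on)
  moreover have "f 0 \<le> measure lebesgue {0..0::real}"
    unfolding f_def using M
    by (intro measure_mono_fmeasurable lmeasurable_unit_subset) auto
  then have "f 0 \<le> \<tau>" using \<tau> by simp
  moreover have "M \<inter> {0..1} = M" using M by auto
  then have "\<tau> \<le> f 1" using \<tau> by (simp add: f_def)
  ultimately obtain s where "f s = \<tau>" using IVT'[of f 0 \<tau> 1] by auto
  then show ?thesis using M lm[of s] by (intro that[of "M \<inter> {0..s}"]) (auto simp: f_def)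
qed

lemma ereal_le_essinf_on:
  assumes "w \<in> borel_measurable leb01" "A \<subseteq> {0..1}" "\<And>t. t \<in> A \<Longrightarrow> c \<le> w t"
  shows "ereal c \<le> essinf_on A w"
proof -
  have [measurable]: "w \<in> borel_measurable (lebesgue_on A)"
    using assms(1,2) by (rule measurable_restrict_mono)
  have "esssup (lebesgue_on A) (\<lambda>t. - ereal (w t)) \<le> - ereal c"
    using assms(3) by (intro esssup_I AE_I2) auto
  then have "- (- ereal c) \<le> - esssup (lebesgue_on A) (\<lambda>t. - ereal (w t))"
    by (simp only: ereal_minus_le_minus)
  then show ?thesis by (simp add: essinf_on_def)
qed

lemma esssup_on_le_ereal:
  assumes "w \<in> borel_measurable leb01" "A \<subseteq> {0..1}" "\<And>t. t \<in> A \<Longrightarrow> w t \<le> c"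
  shows "esssup_on A w \<le> ereal c"
proof -
  have [measurable]: "w \<in> borel_measurable (lebesgue_on A)"
    using assms(1,2) by (rule measurable_restrict_mono)
  show ?thesis
    unfolding esssup_on_def using assms(3) by (intro esssup_I AE_I2) auto
qed

text \<open>Sorting the negated values puts the largest \<open>k\<close> first. Indices start at 1
  to match \<open>decomposable\<close>, whence the shift \<open>i - 1\<close> into the list.\<close>

lemma decreasing_enumeration:
  fixes k :: "'i \<Rightarrow> int"
  assumes R: "finite R" and k: "inj_on k R"
  obtains h where "bij_betw h {1..card R} R" "\<And>i. i \<in> {1..<card R} \<Longrightarrow> k (h (Suc i)) < k (h i)"
proof -
  define xs where "xs = sorted_list_of_set ((\<lambda>r. - k r) ` R)"
  have inj: "inj_on (\<lambda>r. - k r) R" using k by (auto simp: inj_on_def)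
  have len: "length xs = card R" by (simp add: xs_def card_image[OF inj])
  have set: "set xs = (\<lambda>r. - k r) ` R" using R by (simp add: xs_def)
  define h where "h = inv_into R (\<lambda>r. - k r) \<circ> ((!) xs \<circ> (\<lambda>i. i - 1))"
  have "bij_betw (\<lambda>i. i - 1) {1..card R} {..<length xs}"
    by (rule bij_betw_byWitness[of _ Suc]) (auto simp: len)
  moreover have "bij_betw ((!) xs) {..<length xs} ((\<lambda>r. - k r) ` R)"
    by (rule bij_betw_nth) (auto simp: xs_def R)
  moreover have "bij_betw (inv_into R (\<lambda>r. - k r)) ((\<lambda>r. - k r) ` R) R"
    by (intro bij_betw_inv_into inj_on_imp_bij_betw inj)
  ultimately have bij: "bij_betw h {1..card R} R"
    unfolding h_def by (blast intro: bij_betw_trans)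
  have kh: "- k (h i) = xs ! (i - 1)" if "i \<in> {1..card R}" for i
  proof -
    have "xs ! (i - 1) \<in> (\<lambda>r. - k r) ` R" using that len set nth_mem[of "i - 1" xs] by auto
    then show ?thesis unfolding h_def comp_def by (rule f_inv_into_f)
  qed
  have sorted: "sorted_wrt (<) xs" unfolding xs_def by (rule strict_sorted_list_of_set)
  show ?thesis
  proof (rule that[OF bij])
    fix i assume i: "i \<in> {1..<card R}"
    have "xs ! (i - 1) < xs ! i" using sorted_wrt_nth_less[OF sorted, of "i - 1" i] i len by auto
    then show "k (h (Suc i)) < k (h i)" using kh[of i] kh[of "Suc i"] i by simp
  qed
qed

section \<open>Non-increasing rearrangements\<close>

text \<open>A larger \<open>r\<close> admits more thresholds \<open>l\<close>, so the infimum can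
  only drop. The bound \<open>b\<close> is itself a threshold and keeps the sets nonempty.\<close>

lemma decreasing_rearrangement_antimono:
  assumes "\<And>k. 0 \<le> a k" "\<And>k. a k \<le> b" "r \<le> r'"
  shows "decreasing_rearrangement a r' \<le> decreasing_rearrangement a r"
  unfolding decreasing_rearrangement_def
proof (rule cInf_superset_mono)
  have "{k. b < a k} = {}" using assms(2) by (auto simp: not_less)
  moreover have "0 \<le> b" using assms(1,2) order_trans by blast
  ultimately show "{l. 0 \<le> l \<and> finite {k. l < a k} \<and> card {k. l < a k} \<le> r} \<noteq> {}"
    by (auto intro!: exI[of _ b])
  show "bdd_below {l. 0 \<le> l \<and> finite {k. l < a k} \<and> card {k. l < a k} \<le> r'}"
    by (rule bdd_belowI[of _ 0]) auto
qed (use assms(3) in auto)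

lemma decreasing_rearrangement_enumeration:
  fixes a :: "'i \<Rightarrow> real"
  assumes inf: "infinite (UNIV :: 'i set)" and nonneg: "\<And>i. 0 \<le> a i"
    and fin: "\<And>l. 0 < l \<Longrightarrow> finite {i. l < a i}"
  obtains k :: "nat \<Rightarrow> 'i" where "inj k" "\<And>r. decreasing_rearrangement a r \<le> a (k r)"
proof -
  \<comment> \<open>Greedy choice: \<open>k r\<close> maximises \<open>a\<close> outside \<open>k ` {..<r}\<close>.\<close>
  have pick: "\<exists>j. j \<notin> A \<and> (\<forall>i. i \<notin> A \<longrightarrow> a i \<le> a j)" if A: "finite A" for A
  proof (cases "\<exists>i. i \<notin> A \<and> 0 < a i")
    case True
    then obtain i0 where i0: "i0 \<notin> A" "0 < a i0" by blast
    \<comment> \<open>This set is finite, so \<open>a\<close> attains its maximum on it; an index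
      outside both \<open>S\<close> and \<open>A\<close> has a value of at most
      \<open>a i0 / 2\<close> and cannot beat that maximum.\<close>
    define S where "S = {i. a i0 / 2 < a i} - A"
    have S: "finite S" "i0 \<in> S" using fin[of "a i0 / 2"] i0 by (auto simp: S_def)
    then have "Max (a ` S) \<in> a ` S" by (intro Max_in) auto
    then obtain j where j: "j \<in> S" "a j = Max (a ` S)" by auto
    have max: "a i \<le> a j" if "i \<in> S" for i using S(1) that unfolding j(2) by simp
    have "a i \<le> a j" if "i \<notin> A" for i
    proof (cases "i \<in> S")
      case False
      then have "a i \<le> a i0 / 2" using that by (simp add: S_def not_less)
      also have "\<dots> \<le> a i0" using i0 by simp
      also have "\<dots> \<le> a j" using S by (intro max)
      finally show ?thesis .
    qed (rule max)
    then show ?thesis using j(1) by (auto simp: S_def)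
  next
    case False
    obtain j where "j \<notin> A" using ex_new_if_finite[OF inf A] by blast
    then show ?thesis using False nonneg[of j] by (auto simp: not_less intro: order_trans)
  qed
  have "\<exists>k::nat \<Rightarrow> 'i. \<forall>r. k r \<notin> k ` {..<r} \<and> (\<forall>i. i \<notin> k ` {..<r} \<longrightarrow> a i \<le> a (k r))"
  proof (rule dependent_wellorder_choice)
    fix j r and f g :: "nat \<Rightarrow> 'i" assume "\<And>s. s < r \<Longrightarrow> f s = g s"
    then have "f ` {..<r} = g ` {..<r}" by auto
    then show "(j \<notin> f ` {..<r} \<and> (\<forall>i. i \<notin> f ` {..<r} \<longrightarrow> a i \<le> a j)) =
        (j \<notin> g ` {..<r} \<and> (\<forall>i. i \<notin> g ` {..<r} \<longrightarrow> a i \<le> a j))" by simp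
  qed (rule pick, simp)
  then obtain k :: "nat \<Rightarrow> 'i" where k: "\<And>r. k r \<notin> k ` {..<r}"
    "\<And>r i. i \<notin> k ` {..<r} \<Longrightarrow> a i \<le> a (k r)" by blast
  show ?thesis
  proof
    have "k r \<noteq> k s" if "s < r" for r s using k(1)[of r] that by auto
    then show "inj k" by (metis injI linorder_neqE_nat)
    fix r
    \<comment> \<open>Only indices chosen earlier can exceed \<open>a (k r)\<close>. There are at
      most \<open>r\<close> of them, so \<open>a (k r)\<close> is an admissible threshold in the
      infimum.\<close>
    have sub: "{i. a (k r) < a i} \<subseteq> k ` {..<r}" using k(2)[of _ r] by (auto simp: not_less[symmetric])
    then have "finite {i. a (k r) < a i}" by (rule finite_subset) simp
    moreover have "card {i. a (k r) < a i} \<le> r"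
      using card_mono[OF _ sub] card_image_le[of "{..<r}" k] by simp
    ultimately show "decreasing_rearrangement a r \<le> a (k r)"
      unfolding decreasing_rearrangement_def using nonneg
      by (intro cInf_lower bdd_belowI[of _ 0]) auto
  qed
qed

section \<open>Dyadic level sets and the sequence of their measures\<close>

lemma level_set_measurable:
  assumes "w \<in> borel_measurable leb01"
  shows "level_set w k \<in> sets lebesgue"
proof -
  have "{t \<in> space leb01. 2 powi k \<le> w t \<and> w t < 2 powi (k + 1)} \<in> sets leb01"
    using assms by measurable
  then show ?thesis by (simp add: level_set_def sets_restrict_space_iff)
qed

lemma level_set_subset: "level_set w k \<subseteq> {0..1}"
  by (auto simp: level_set_def)

lemma level_set_disjoint:
  assumes "j \<noteq> k" shows "level_set w j \<inter> level_set w k = {}"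
proof -
  have "level_set w i \<inter> level_set w l = {}" if "i < l" for i l
  proof -
    have "2 powi (i + 1) \<le> (2 powi l :: real)" using that by (intro power_int_increasing) auto
    then show ?thesis by (auto simp: level_set_def)
  qed
  from this[of j k] this[of k j] assms show ?thesis by (cases j k rule: linorder_cases) auto
qed

lemma sum_level_sets_le_1:
  assumes w: "w \<in> borel_measurable leb01" and F: "finite F"
  shows "(\<Sum>k\<in>F. measure lebesgue (level_set w k)) \<le> 1"
proof -
  note meas = level_set_measurable[OF w]
  have lm: "level_set w k \<in> lmeasurable" for k by (rule lmeasurable_unit_subset[OF meas level_set_subset])
  have "(\<Sum>k\<in>F. measure lebesgue (level_set w k)) = measure lebesgue (\<Union>k\<in>F. level_set w k)"
    using F lm level_set_disjoint by (intro measure_UNION'[symmetric]) (auto simp: pairwise_def disjnt_def)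
  also have "\<dots> \<le> measure lebesgue {0..1::real}"
    using F meas level_set_subset by (intro measure_mono_fmeasurable UN_least sets.finite_UN) auto
  finally show ?thesis by simp
qed

text \<open>The level sets are disjoint in an interval of length 1, so fewer than \<open>n\<close>
  of them can exceed \<open>l\<close> once \<open>n * l > 1\<close>.\<close>

lemma finite_large_level_sets:
  assumes w: "w \<in> borel_measurable leb01" and l: "0 < l"
  shows "finite {k. l < measure lebesgue (level_set w k)}"
proof (rule ccontr)
  assume inf: "infinite {k. l < measure lebesgue (level_set w k)}"
  obtain n where n: "1 < real n * l" using reals_Archimedean3[OF l] by blast
  obtain F where F: "finite F" "card F = n" "F \<subseteq> {k. l < measure lebesgue (level_set w k)}"
    using infinite_arbitrarily_large[OF inf] by blast
  have "real n * l \<le> (\<Sum>k\<in>F. measure lebesgue (level_set w k))"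
    using F by (subst F(2)[symmetric], intro sum_bounded_below) auto
  with sum_level_sets_le_1[OF w F(1)] n show False by simp
qed

text \<open>Provides distinct level sets in which pieces of length up to
  \<open>weight_seq w r\<close> can be placed.\<close>

lemma weight_seq_enumeration:
  assumes "w \<in> borel_measurable leb01"
  obtains k :: "nat \<Rightarrow> int" where "inj k" "\<And>r. weight_seq w r \<le> measure lebesgue (level_set w (k r))"
proof (rule decreasing_rearrangement_enumeration)
  show "infinite (UNIV :: int set)" by simp
  show "0 \<le> measure lebesgue (level_set w k)" for k by simp
  show "finite {k. l < measure lebesgue (level_set w k)}" if "0 < l" for l
    using assms that by (rule finite_large_level_sets)
qed (use that in \<open>simp add: weight_seq_def\<close>)

lemma weight_seq_antimono:
  assumes "w \<in> borel_measurable leb01" "r \<le> r'"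
  shows "weight_seq w r' \<le> weight_seq w r"
  unfolding weight_seq_def
proof (rule decreasing_rearrangement_antimono[OF _ _ assms(2)])
  show "measure lebesgue (level_set w k) \<le> 1" for k
    using sum_level_sets_le_1[OF assms(1), of "{k}"] by simp
qed simp

lemma sum_weight_seq_le_1:
  assumes "w \<in> borel_measurable leb01"
  shows "(\<Sum>r<n. weight_seq w r) \<le> 1"
proof -
  obtain k :: "nat \<Rightarrow> int" where k: "inj k" "\<And>r. weight_seq w r \<le> measure lebesgue (level_set w (k r))"
    by (rule weight_seq_enumeration[OF assms]) (rule that; blast)
  have "(\<Sum>r<n. weight_seq w r) \<le> (\<Sum>r<n. measure lebesgue (level_set w (k r)))"
    by (intro sum_mono k)
  also have "\<dots> = (\<Sum>j\<in>k ` {..<n}. measure lebesgue (level_set w j))"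
    using k(1) by (subst sum.reindex) (auto simp: inj_on_def)
  also have "\<dots> \<le> 1" by (rule sum_level_sets_le_1[OF assms]) simp
  finally show ?thesis .
qed

section \<open>Symmetric spaces\<close>

context symmetric_space
begin

section \<open>Indicator functions and the fundamental function\<close>

lemma indicator_equimeasurable:
  assumes E: "E \<in> sets lebesgue" "E \<subseteq> {0..1}" and F: "F \<in> sets lebesgue" "F \<subseteq> {0..1}"
    and eq: "measure lebesgue E = measure lebesgue F" and mem: "indicator E \<in> X"
  shows "indicator F \<in> X \<and> N (indicator F) = N (indicator E)"
proof (rule rearrangement_invariant[OF mem])
  show "indicator F \<in> borel_measurable leb01"
    using F by (intro borel_measurable_indicator) (auto simp: sets_restrict_space_iff)
  fix l :: real assume l: "l \<ge> 0"
  have "{t \<in> {0..1}. \<bar>indicator G t\<bar> > l} = (if l < 1 then G else {})" if "G \<subseteq> {0..1}" for G :: "real set"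
    using that l by (auto simp: indicator_def split: if_splits)
  then show "measure leb01 {t \<in> {0..1}. \<bar>indicator F t\<bar> > l} = measure leb01 {t \<in> {0..1}. \<bar>indicator E t\<bar> > l}"
    using E F eq by (simp add: measure_restrict_space)
qed

text \<open>A nonzero \<open>x\<close> in the space exceeds \<open>1 / Suc n\<close> in modulus on a
  set of positive measure for some \<open>n\<close>; its indicator is dominated by
  \<open>Suc n\<close> times \<open>x\<close>.\<close>

lemma exists_indicator_mem:
  obtains E where "E \<in> sets lebesgue" "E \<subseteq> {0..1}" "0 < measure lebesgue E" "indicator E \<in> X"
proof -
  obtain x where x: "x \<in> X" "\<not> (AE t in leb01. x t = 0)" using nontrivial by blast
  have [measurable]: "x \<in> borel_measurable leb01" using x measurable by blast
  define E where "E n = {t \<in> space leb01. 1 / real (Suc n) < \<bar>x t\<bar>}" for n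
  have E: "E n \<in> sets leb01" for n unfolding E_def by measurable
  have "\<exists>n. E n \<notin> null_sets leb01"
  proof (rule ccontr)
    assume "\<not> ?thesis"
    then have "(\<Union>n. E n) \<in> null_sets leb01" by (intro null_sets_UN) auto
    moreover have "{t \<in> space leb01. \<not> (x t = 0)} \<subseteq> (\<Union>n. E n)"
    proof
      fix t assume "t \<in> {t \<in> space leb01. \<not> (x t = 0)}"
      then have "t \<in> space leb01" "0 < \<bar>x t\<bar>" by auto
      then show "t \<in> (\<Union>n. E n)"
        using reals_Archimedean[of "\<bar>x t\<bar>"] by (auto simp: E_def inverse_eq_divide)
    qed
    ultimately have "AE t in leb01. x t = 0" by (rule AE_I')
    with x(2) show False ..
  qed
  then obtain n where n: "E n \<notin> null_sets leb01" by blast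
  have En: "E n \<in> sets lebesgue" "E n \<subseteq> {0..1}"
    using E[of n] by (auto simp: sets_restrict_space_iff)
  have "measure lebesgue (E n) \<noteq> 0"
  proof
    assume "measure lebesgue (E n) = 0"
    then have "emeasure lebesgue (E n) = 0"
      using lmeasurable_unit_subset[OF En] by (simp add: emeasure_eq_measure2)
    then show False using n E[of n] En by (auto simp: null_sets_def emeasure_restrict_space)
  qed
  then have pos: "0 < measure lebesgue (E n)" by (simp add: less_le)
  have "(\<lambda>t. real (Suc n) * x t) \<in> X" by (rule scale_mem[OF x(1)])
  moreover have "indicator (E n) \<in> borel_measurable leb01" using E by simp
  moreover have "AE t in leb01. \<bar>indicator (E n) t\<bar> \<le> \<bar>real (Suc n) * x t\<bar>"
    by (intro AE_I2) (auto simp: E_def indicator_def abs_mult field_simps)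
  ultimately have "indicator (E n) \<in> X" using ideal by blast
  with En pos show ?thesis by (intro that)
qed

text \<open>One set of measure \<open>\<delta> > 0\<close> yields, by rearrangement invariance, all
  intervals of length \<open>\<delta>\<close> inside the unit interval. Finitely many of them cover
  it, and the ideal property does the rest.\<close>

lemma indicator_mem:
  assumes "E \<in> sets lebesgue" "E \<subseteq> {0..1}"
  shows "indicator E \<in> X"
proof -
  obtain E0 where E0: "E0 \<in> sets lebesgue" "E0 \<subseteq> {0..1}" "0 < measure lebesgue E0" "indicator E0 \<in> X"
    by (rule exists_indicator_mem)
  define \<delta> where "\<delta> = measure lebesgue E0"
  have "\<delta> \<le> measure lebesgue {0..1::real}"
    unfolding \<delta>_def using E0 by (intro measure_mono_fmeasurable) auto
  then have \<delta>: "0 < \<delta>" "\<delta> \<le> 1" using E0 by (auto simp: \<delta>_def)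
  have shift: "indicator {a..a + \<delta>} \<in> X" if "0 \<le> a" "a + \<delta> \<le> 1" for a
    using that \<delta> by (intro conjunct1[OF indicator_equimeasurable[OF E0(1,2) _ _ _ E0(4)]])
      (auto simp: \<delta>_def[symmetric])
  have "indicator {0..min 1 (real (Suc n) * \<delta>)} \<in> X" for n
  proof (induction n)
    case 0
    then show ?case using shift[of 0] \<delta> by simp
  next
    case (Suc n)
    \<comment> \<open>The cap at \<open>1 - \<delta>\<close> keeps the new interval inside the unit
      interval. It overlaps or touches the part already covered and ends exactly at
      \<open>min 1 (real (Suc (Suc n)) * \<delta>)\<close>.\<close>
    define a where "a = min (1 - \<delta>) (real (Suc n) * \<delta>)"
    have "indicator {a..a + \<delta>} \<in> X" using \<delta> by (intro shift) (auto simp: a_def)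
    from add_mem[OF Suc this]
    have "(\<lambda>t. indicator {0..min 1 (real (Suc n) * \<delta>)} t + indicator {a..a + \<delta>} t) \<in> X" .
    moreover have "indicator {0..min 1 (real (Suc (Suc n)) * \<delta>)} \<in> borel_measurable leb01"
      by (intro borel_measurable_indicator) (auto simp: sets_restrict_space_iff)
    moreover have "\<bar>indicator {0..min 1 (real (Suc (Suc n)) * \<delta>)} t\<bar>
        \<le> \<bar>indicator {0..min 1 (real (Suc n) * \<delta>)} t + indicator {a..a + \<delta>} t :: real\<bar>" for t :: real
      using \<delta> by (auto simp: indicator_def a_def min_def algebra_simps split: if_splits)
    ultimately show ?case using ideal by blast
  qed
  moreover obtain n where "1 < real n * \<delta>" using reals_Archimedean3[OF \<delta>(1)] by blast
  then have "1 \<le> real (Suc n) * \<delta>" using \<delta> by (simp add: algebra_simps)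
  ultimately have "indicator {0..1} \<in> X" by (metis min_absorb1)
  moreover have "indicator E \<in> borel_measurable leb01"
    using assms by (intro borel_measurable_indicator) (auto simp: sets_restrict_space_iff)
  moreover have "AE t in leb01. \<bar>indicator E t :: real\<bar> \<le> \<bar>indicator {0..1} t\<bar>"
    using assms by (intro AE_I2) (auto simp: indicator_def)
  ultimately show ?thesis using ideal by blast
qed

lemma norm_indicator:
  assumes "E \<in> sets lebesgue" "E \<subseteq> {0..1}"
  shows "N (indicator E) = fundamental_function N (measure lebesgue E)"
proof -
  have "measure lebesgue E \<le> measure lebesgue {0..1::real}"
    using assms by (intro measure_mono_fmeasurable) auto
  then have "{0..measure lebesgue E} \<subseteq> {0..1}" by auto
  then show ?thesis unfolding fundamental_function_def
    using indicator_equimeasurable[of "{0..measure lebesgue E}" E] indicator_mem assms by simp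
qed

lemma norm_indicator_eq_0_iff:
  assumes "E \<in> sets lebesgue" "E \<subseteq> {0..1}"
  shows "N (indicator E) = 0 \<longleftrightarrow> measure lebesgue E = 0"
proof -
  have "N (indicator E) = 0 \<longleftrightarrow> (AE t in leb01. t \<notin> E)"
    by (simp add: norm_eq_0_iff indicator_mem assms indicator_eq_0_iff)
  also have "\<dots> \<longleftrightarrow> E \<in> null_sets leb01"
    using assms by (intro AE_iff_null_sets[symmetric]) (auto simp: sets_restrict_space_iff)
  also have "\<dots> \<longleftrightarrow> emeasure lebesgue E = 0"
    using assms by (auto simp: null_sets_def emeasure_restrict_space sets_restrict_space_iff)
  also have "\<dots> \<longleftrightarrow> measure lebesgue E = 0"
    using lmeasurable_unit_subset[OF assms] by (simp add: emeasure_eq_measure2)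
  finally show ?thesis .
qed

lemma norm_mono:
  assumes "y \<in> X" "x \<in> X" "\<And>t. t \<in> {0..1} \<Longrightarrow> \<bar>x t\<bar> \<le> \<bar>y t\<bar>"
  shows "N x \<le> N y"
proof -
  have "x \<in> borel_measurable leb01" using assms(2) measurable by blast
  moreover have "AE t in leb01. \<bar>x t\<bar> \<le> \<bar>y t\<bar>" using assms(3) by (intro AE_I2) auto
  ultimately show ?thesis using ideal[OF assms(1)] by blast
qed

lemma fundamental_function_pos: "0 < t \<Longrightarrow> t \<le> 1 \<Longrightarrow> 0 < fundamental_function N t"
  using norm_indicator_eq_0_iff[of "{0..t}"] norm_nonneg[OF indicator_mem, of "{0..t}"]
  by (simp add: fundamental_function_def)

lemma fundamental_function_mono:
  "0 < s \<Longrightarrow> s \<le> t \<Longrightarrow> t \<le> 1 \<Longrightarrow> fundamental_function N s \<le> fundamental_function N t"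
  unfolding fundamental_function_def
  by (intro norm_mono indicator_mem) (auto simp: indicator_def)

lemma fundamental_function_subadd:
  assumes "0 < s" "0 < t" "s + t \<le> 1"
  shows "fundamental_function N (s + t) \<le> fundamental_function N s + fundamental_function N t"
proof -
  have eq: "indicator {0..s + t} = (\<lambda>u. indicator {0..s} u + indicator {s<..s + t} u :: real)"
    using assms by (auto simp: indicator_def fun_eq_iff)
  have "N (indicator {0..s + t}) \<le> N (indicator {0..s}) + N (indicator {s<..s + t})"
    unfolding eq using assms by (intro norm_triangle indicator_mem) auto
  also have "N (indicator {s<..s + t}) = fundamental_function N t"
    using assms by (subst norm_indicator) auto
  finally show ?thesis by (simp add: fundamental_function_def)
qed

section \<open>Decomposability applied to functions on level sets\<close>

lemma sum_mem: "finite R \<Longrightarrow> (\<And>r. r \<in> R \<Longrightarrow> x r \<in> X) \<Longrightarrow> (\<lambda>t. \<Sum>r\<in>R. x r t) \<in> X"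
  by (induction R rule: finite_induct) (auto simp: zero_mem intro: add_mem)

text \<open>Distinct indices of equal parity differ by at least 2. If \<open>j + 2 \<le> i\<close>,
  then \<open>w\<close> is at least \<open>2 powi i\<close> on the higher set and below
  \<open>2 powi (j + 1)\<close> on the lower one, which gives the required factor 2.\<close>

lemma norm_sum_le_same_parity:
  fixes k :: "'i \<Rightarrow> int"
  assumes w: "w \<in> borel_measurable leb01"
    and dec: "\<And>(n::nat) x y. (\<forall>i\<in>{1..n}. x i \<in> X \<and> y i \<in> X \<and>
           \<not> (AE t in leb01. x i t = 0) \<and> \<not> (AE t in leb01. y i t = 0) \<and> N (x i) = N (y i)) \<Longrightarrow>
        (\<forall>i\<in>{1..<n}. essinf_on (supp (x i) \<union> supp (y i)) w
           \<ge> 2 * esssup_on (supp (x (Suc i)) \<union> supp (y (Suc i))) w) \<Longrightarrow>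
        N (\<lambda>t. \<Sum>i=1..n. y i t) \<le> C * N (\<lambda>t. \<Sum>i=1..n. x i t)"
    and R: "finite R" "inj_on k R" "\<And>r. r \<in> R \<Longrightarrow> k r mod 2 = b"
    and x: "\<And>r. r \<in> R \<Longrightarrow> x r \<in> X \<and> supp (x r) \<subseteq> level_set w (k r)"
    and y: "\<And>r. r \<in> R \<Longrightarrow> y r \<in> X \<and> supp (y r) \<subseteq> level_set w (k r)"
    and xy: "\<And>r. r \<in> R \<Longrightarrow> N (x r) = N (y r) \<and> N (y r) \<noteq> 0"
  shows "N (\<lambda>t. \<Sum>r\<in>R. x r t) \<le> C * N (\<lambda>t. \<Sum>r\<in>R. y r t)"
proof -
  obtain h where h: "bij_betw h {1..card R} R"
      "\<And>i. i \<in> {1..<card R} \<Longrightarrow> k (h (Suc i)) < k (h i)"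
    by (rule decreasing_enumeration[OF R(1,2)]) (rule that, assumption, blast)
  have hR: "h i \<in> R" if "i \<in> {1..card R}" for i using h(1) that by (rule bij_betwE[rule_format])
  \<comment> \<open>The families \<open>x\<close> and \<open>y\<close> exchange their roles in
    \<open>dec\<close>.\<close>
  have "N (\<lambda>t. \<Sum>i=1..card R. x (h i) t) \<le> C * N (\<lambda>t. \<Sum>i=1..card R. y (h i) t)"
  proof (rule dec)
    show "\<forall>i\<in>{1..card R}. y (h i) \<in> X \<and> x (h i) \<in> X \<and> \<not> (AE t in leb01. y (h i) t = 0) \<and>
        \<not> (AE t in leb01. x (h i) t = 0) \<and> N (y (h i)) = N (x (h i))"
      using hR x y xy by (metis norm_eq_0_iff)
    show "\<forall>i\<in>{1..<card R}. 2 * esssup_on (supp (y (h (Suc i))) \<union> supp (x (h (Suc i)))) w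
        \<le> essinf_on (supp (y (h i)) \<union> supp (x (h i))) w"
    proof
      fix i assume i: "i \<in> {1..<card R}"
      then have mem: "h i \<in> R" "h (Suc i) \<in> R" using hR by auto
      define S where "S j = supp (y (h j)) \<union> supp (x (h j))" for j
      have S: "S i \<subseteq> level_set w (k (h i))" "S (Suc i) \<subseteq> level_set w (k (h (Suc i)))"
        using x y mem by (auto simp: S_def)
      have "k (h (Suc i)) mod 2 = k (h i) mod 2" using R(3) mem by simp
      with h(2)[OF i] have gap: "k (h (Suc i)) + 2 \<le> k (h i)" by presburger
      have "esssup_on (S (Suc i)) w \<le> ereal (2 powi (k (h (Suc i)) + 1))"
        using S(2) by (intro esssup_on_le_ereal w) (auto simp: level_set_def)
      then have "2 * esssup_on (S (Suc i)) w \<le> 2 * ereal (2 powi (k (h (Suc i)) + 1))"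
        by (rule ereal_mult_left_mono) simp
      also have "\<dots> = ereal (2 powi (k (h (Suc i)) + 2))"
        using power_int_add_1'[of "2::real" "k (h (Suc i)) + 1"] by (simp add: add.assoc)
      also have "\<dots> \<le> ereal (2 powi (k (h i)))"
        using gap by (auto intro: power_int_increasing)
      also have "\<dots> \<le> essinf_on (S i) w"
        using S(1) by (intro ereal_le_essinf_on w) (auto simp: level_set_def)
      finally show "2 * esssup_on (supp (y (h (Suc i))) \<union> supp (x (h (Suc i)))) w
          \<le> essinf_on (supp (y (h i)) \<union> supp (x (h i))) w" by (simp add: S_def)
    qed
  qed
  moreover have "(\<Sum>i=1..card R. z (h i) t) = (\<Sum>r\<in>R. z r t)" for z :: "'i \<Rightarrow> real \<Rightarrow> real" and t
    by (rule sum.reindex_bij_betw[OF h(1)])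
  ultimately show ?thesis by simp
qed

text \<open>The triangle inequality splits the sum of \<open>x\<close> into two parity classes and
  costs the factor 2. Nonnegativity of \<open>y\<close> bounds each parity part of its sum by the
  full sum.\<close>

lemma decomposable_norm_sum_le:
  assumes w: "w \<in> borel_measurable leb01" and dec: "decomposable w X N"
  obtains C where "0 < C"
    "\<And>(k :: nat \<Rightarrow> int) R x y. finite R \<Longrightarrow> inj_on k R \<Longrightarrow>
      (\<And>r. r \<in> R \<Longrightarrow> x r \<in> X \<and> supp (x r) \<subseteq> level_set w (k r)) \<Longrightarrow>
      (\<And>r. r \<in> R \<Longrightarrow> y r \<in> X \<and> supp (y r) \<subseteq> level_set w (k r)) \<Longrightarrow>
      (\<And>r. r \<in> R \<Longrightarrow> N (x r) = N (y r) \<and> N (y r) \<noteq> 0) \<Longrightarrow>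
      (\<And>r t. r \<in> R \<Longrightarrow> 0 \<le> y r t) \<Longrightarrow>
      N (\<lambda>t. \<Sum>r\<in>R. x r t) \<le> C * N (\<lambda>t. \<Sum>r\<in>R. y r t)"
proof -
  obtain C where C: "0 < C" and dec': "\<And>(n::nat) x y. (\<forall>i\<in>{1..n}. x i \<in> X \<and> y i \<in> X \<and>
           \<not> (AE t in leb01. x i t = 0) \<and> \<not> (AE t in leb01. y i t = 0) \<and> N (x i) = N (y i)) \<Longrightarrow>
        (\<forall>i\<in>{1..<n}. essinf_on (supp (x i) \<union> supp (y i)) w
           \<ge> 2 * esssup_on (supp (x (Suc i)) \<union> supp (y (Suc i))) w) \<Longrightarrow>
        N (\<lambda>t. \<Sum>i=1..n. y i t) \<le> C * N (\<lambda>t. \<Sum>i=1..n. x i t)"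
    using dec unfolding decomposable_def by blast
  show ?thesis
  proof (rule that[of "2 * C"])
    show "0 < 2 * C" using C by simp
    fix k :: "nat \<Rightarrow> int" and R x y
    assume R: "finite R" "inj_on k R"
      and x: "\<And>r. r \<in> R \<Longrightarrow> x r \<in> X \<and> supp (x r) \<subseteq> level_set w (k r)"
      and y: "\<And>r. r \<in> R \<Longrightarrow> y r \<in> X \<and> supp (y r) \<subseteq> level_set w (k r)"
      and xy: "\<And>r. r \<in> R \<Longrightarrow> N (x r) = N (y r) \<and> N (y r) \<noteq> 0"
      and y0: "\<And>r t. r \<in> R \<Longrightarrow> 0 \<le> y r t"
    \<comment> \<open>Neighbouring level sets are not separated by a factor 2, those of equal parity are.\<close>
    define P where "P b = {r \<in> R. k r mod 2 = b}" for b
    have P: "finite (P b)" "P b \<subseteq> R" for b using R by (auto simp: P_def)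
    have part: "N (\<lambda>t. \<Sum>r\<in>P b. x r t) \<le> C * N (\<lambda>t. \<Sum>r\<in>R. y r t)" for b
    proof -
      have "N (\<lambda>t. \<Sum>r\<in>P b. x r t) \<le> C * N (\<lambda>t. \<Sum>r\<in>P b. y r t)"
        using R(2) x y xy P by (intro norm_sum_le_same_parity[OF w dec', of "P b" k b])
          (auto simp: P_def inj_on_def)
      also have "N (\<lambda>t. \<Sum>r\<in>P b. y r t) \<le> N (\<lambda>t. \<Sum>r\<in>R. y r t)"
      proof (rule norm_mono)
        fix t :: real
        have "0 \<le> (\<Sum>r\<in>P b. y r t)" using y0 subsetD[OF P(2)] by (intro sum_nonneg) blast
        moreover have "(\<Sum>r\<in>P b. y r t) \<le> (\<Sum>r\<in>R. y r t)" using y0 P R by (intro sum_mono2) auto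
        ultimately show "\<bar>\<Sum>r\<in>P b. y r t\<bar> \<le> \<bar>\<Sum>r\<in>R. y r t\<bar>" by simp
      qed (use R P y in \<open>auto intro!: sum_mem\<close>)
      finally show ?thesis using C by simp
    qed
    have split: "(\<Sum>r\<in>R. x r t) = (\<Sum>r\<in>P 0. x r t) + (\<Sum>r\<in>P 1. x r t)" for t
      using R(1) by (subst sum.union_disjoint[symmetric]) (auto simp: P_def intro!: sum.cong)
    have "N (\<lambda>t. \<Sum>r\<in>R. x r t) \<le> N (\<lambda>t. \<Sum>r\<in>P 0. x r t) + N (\<lambda>t. \<Sum>r\<in>P 1. x r t)"
      unfolding split using P x by (intro norm_triangle sum_mem) auto
    with part[of 0] part[of 1]
    show "N (\<lambda>t. \<Sum>r\<in>R. x r t) \<le> 2 * C * N (\<lambda>t. \<Sum>r\<in>R. y r t)" by simp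
  qed
qed

lemma norm_sum_indicator:
  assumes "finite R" "\<And>r. r \<in> R \<Longrightarrow> E r \<in> sets lebesgue \<and> E r \<subseteq> {0..1}" "disjoint_family_on E R"
  shows "N (\<lambda>t. \<Sum>r\<in>R. indicator (E r) t) = fundamental_function N (\<Sum>r\<in>R. measure lebesgue (E r))"
proof -
  have "(\<lambda>t. \<Sum>r\<in>R. indicator (E r) t) = (indicator (\<Union>r\<in>R. E r) :: real \<Rightarrow> real)"
    by (auto simp: fun_eq_iff indicator_UN_disjoint[OF assms(1,3)])
  moreover have "measure lebesgue (\<Union>r\<in>R. E r) = (\<Sum>r\<in>R. measure lebesgue (E r))"
    using assms by (intro measure_UNION')
      (auto simp: pairwise_def disjnt_def disjoint_family_on_def intro: lmeasurable_unit_subset)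
  moreover have "N (indicator (\<Union>r\<in>R. E r)) = fundamental_function N (measure lebesgue (\<Union>r\<in>R. E r))"
    using assms by (intro norm_indicator) (auto intro!: sets.finite_UN)
  ultimately show ?thesis by simp
qed

text \<open>Realise the lengths as measures of sets \<open>E r\<close> and \<open>F r\<close> in the
  level set \<open>k r\<close>. Sums of their indicators have the norms
  \<open>\<phi> (\<Sum>r<n. \<tau> r)\<close> and
  \<open>\<phi> (\<Sum>r<n. \<sigma> r)\<close>.\<close>

lemma level_comparable_fundamental_function:
  assumes w: "w \<in> borel_measurable leb01" and dec: "decomposable w X N"
    and pos: "\<And>r. 0 < weight_seq w r"
  obtains K where "level_comparable (fundamental_function N) (weight_seq w) K"
proof -
  obtain K where K: "0 < K" and
    compare: "\<And>(k :: nat \<Rightarrow> int) R x y. finite R \<Longrightarrow> inj_on k R \<Longrightarrow>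
      (\<And>r. r \<in> R \<Longrightarrow> x r \<in> X \<and> supp (x r) \<subseteq> level_set w (k r)) \<Longrightarrow>
      (\<And>r. r \<in> R \<Longrightarrow> y r \<in> X \<and> supp (y r) \<subseteq> level_set w (k r)) \<Longrightarrow>
      (\<And>r. r \<in> R \<Longrightarrow> N (x r) = N (y r) \<and> N (y r) \<noteq> 0) \<Longrightarrow>
      (\<And>r t. r \<in> R \<Longrightarrow> 0 \<le> y r t) \<Longrightarrow>
      N (\<lambda>t. \<Sum>r\<in>R. x r t) \<le> K * N (\<lambda>t. \<Sum>r\<in>R. y r t)"
    by (rule decomposable_norm_sum_le[OF w dec]) (rule that; blast)
  obtain k :: "nat \<Rightarrow> int" where k: "inj k" "\<And>r. weight_seq w r \<le> measure lebesgue (level_set w (k r))"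
    by (rule weight_seq_enumeration[OF w]) (rule that; blast)
  let ?\<phi> = "fundamental_function N"
  have sets: "\<exists>E. \<forall>r<n. E r \<subseteq> level_set w (k r) \<and> E r \<in> sets lebesgue \<and> measure lebesgue (E r) = \<rho> r"
    if "\<And>r. r < n \<Longrightarrow> 0 < \<rho> r \<and> \<rho> r \<le> weight_seq w r" for n \<rho>
  proof -
    have "\<exists>E. E \<subseteq> level_set w (k r) \<and> E \<in> sets lebesgue \<and> measure lebesgue E = \<rho> r" if "r < n" for r
      using exists_subset_of_measure[OF level_set_measurable[OF w] level_set_subset, of "\<rho> r" "k r"]
        \<open>\<And>r. r < n \<Longrightarrow> 0 < \<rho> r \<and> \<rho> r \<le> weight_seq w r\<close>[OF that] k(2)[of r]
      by (metis less_imp_le order_trans)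
    then show ?thesis by metis
  qed
  have "level_comparable ?\<phi> (weight_seq w) K"
  proof
    fix n :: nat and \<tau> \<sigma> c
    assume n: "0 < n" and \<tau>: "\<And>r. r < n \<Longrightarrow> 0 < \<tau> r \<and> \<tau> r \<le> weight_seq w r"
      and \<sigma>: "\<And>r. r < n \<Longrightarrow> 0 < \<sigma> r \<and> \<sigma> r \<le> weight_seq w r"
      and le: "\<And>r. r < n \<Longrightarrow> ?\<phi> (\<tau> r) \<le> c * ?\<phi> (\<sigma> r)"
    obtain E where E: "\<And>r. r < n \<Longrightarrow> E r \<subseteq> level_set w (k r) \<and> E r \<in> sets lebesgue \<and> measure lebesgue (E r) = \<tau> r"
      using sets[of n \<tau>, OF \<tau>] by blast
    obtain F where F: "\<And>r. r < n \<Longrightarrow> F r \<subseteq> level_set w (k r) \<and> F r \<in> sets lebesgue \<and> measure lebesgue (F r) = \<sigma> r"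
      using sets[of n \<sigma>, OF \<sigma>] by blast
    have E01: "r < n \<Longrightarrow> E r \<in> sets lebesgue \<and> E r \<subseteq> {0..1}"
      and F01: "r < n \<Longrightarrow> F r \<in> sets lebesgue \<and> F r \<subseteq> {0..1}" for r
      using E F level_set_subset by blast+
    have disj: "disjoint_family_on G {..<n}" if "\<And>r. r < n \<Longrightarrow> G r \<subseteq> level_set w (k r)" for G
      unfolding disjoint_family_on_def
    proof (intro ballI impI)
      fix r s assume "r \<in> {..<n}" "s \<in> {..<n}" "r \<noteq> s"
      then show "G r \<inter> G s = {}"
        using level_set_disjoint[of "k r" "k s" w] that[of r] that[of s] k(1) by (auto dest: injD)
    qed
    have w1: "weight_seq w r \<le> 1" for r
      using k(2)[of r] sum_level_sets_le_1[OF w, of "{k r}"] by simp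
    have phi_pos: "0 < ?\<phi> (\<tau> r)" "0 < ?\<phi> (\<sigma> r)" if "r < n" for r
      using \<tau>[OF that] \<sigma>[OF that] w1[of r] by (auto intro!: fundamental_function_pos)
    \<comment> \<open>Decomposability compares functions of equal norm; \<open>d r\<close> rescales
      the indicator of \<open>F r\<close> to the norm of that of \<open>E r\<close>. Since
      \<open>d r \<le> c\<close>, the rescaling is undone afterwards by monotonicity.\<close>
    define d where "d r = ?\<phi> (\<tau> r) / ?\<phi> (\<sigma> r)" for r
    have d: "0 < d r" "d r \<le> c" if "r < n" for r
      using phi_pos[OF that] le[OF that] by (auto simp: d_def field_simps)
    have "N (\<lambda>t. \<Sum>r<n. indicator (E r) t) \<le> K * N (\<lambda>t. \<Sum>r<n. d r * indicator (F r) t)"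
    proof (rule compare[of _ k])
      show "inj_on k {..<n}" using k(1) by (rule inj_on_subset) simp
      fix r assume "r \<in> {..<n}"
      then have r: "r < n" by simp
      show "indicator (E r) \<in> X \<and> supp (indicator (E r)) \<subseteq> level_set w (k r)"
        using E[OF r] E01[OF r] indicator_mem by (auto simp: supp_def indicator_def split: if_splits)
      show "(\<lambda>t. d r * indicator (F r) t) \<in> X \<and> supp (\<lambda>t. d r * indicator (F r) t) \<subseteq> level_set w (k r)"
      proof
        show "(\<lambda>t. d r * indicator (F r) t) \<in> X" using F01[OF r] by (intro scale_mem indicator_mem) auto
        show "supp (\<lambda>t. d r * indicator (F r) t) \<subseteq> level_set w (k r)"
          using F[OF r] by (auto simp: supp_def indicator_def split: if_splits)
      qed
      have "N (\<lambda>t. d r * indicator (F r) t) = ?\<phi> (\<tau> r)"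
        using norm_scale[OF indicator_mem, of "F r" "d r"] norm_indicator[of "F r"] F[OF r] F01[OF r]
          d(1)[OF r] phi_pos[OF r] by (simp add: d_def)
      moreover have "N (indicator (E r)) = ?\<phi> (\<tau> r)"
        using norm_indicator[of "E r"] E[OF r] E01[OF r] by simp
      ultimately show "N (indicator (E r)) = N (\<lambda>t. d r * indicator (F r) t) \<and>
          N (\<lambda>t. d r * indicator (F r) t) \<noteq> 0"
        using phi_pos[OF r] by simp
      show "0 \<le> d r * indicator (F r) t" for t using d(1)[OF r] by simp
    qed simp
    also have "N (\<lambda>t. \<Sum>r<n. d r * indicator (F r) t) \<le> N (\<lambda>t. c * (\<Sum>r<n. indicator (F r) t))"
    proof (rule norm_mono)
      fix t :: real
      have "0 \<le> (\<Sum>r<n. d r * indicator (F r) t)"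
        using d(1) by (intro sum_nonneg mult_nonneg_nonneg) (auto intro: less_imp_le)
      moreover have "(\<Sum>r<n. d r * indicator (F r) t) \<le> (\<Sum>r<n. c * indicator (F r) t)"
        using d(2) by (intro sum_mono mult_right_mono) auto
      ultimately show "\<bar>\<Sum>r<n. d r * indicator (F r) t\<bar> \<le> \<bar>c * (\<Sum>r<n. indicator (F r) t)\<bar>"
        by (simp add: sum_distrib_left)
    next
      show "(\<lambda>t. \<Sum>r<n. d r * indicator (F r) t) \<in> X"
        using F01 by (intro sum_mem scale_mem indicator_mem) auto
      show "(\<lambda>t. c * (\<Sum>r<n. indicator (F r) t)) \<in> X"
        using F01 by (intro scale_mem sum_mem indicator_mem) auto
    qed
    \<comment> \<open>\<open>norm_scale\<close> produces the absolute value of \<open>c\<close>;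
      \<open>0 < d 0 \<le> c\<close>, available because \<open>0 < n\<close>, removes it.\<close>
    also have "\<dots> = c * N (\<lambda>t. \<Sum>r<n. indicator (F r) t)"
      using d[OF n] norm_scale[OF sum_mem[of "{..<n}" "\<lambda>r. indicator (F r)"], of c] F01 indicator_mem by simp
    also have "N (\<lambda>t. \<Sum>r<n. indicator (F r) t) = ?\<phi> (\<Sum>r<n. \<sigma> r)"
      using norm_sum_indicator[of "{..<n}" F] F F01 disj by simp
    also have "N (\<lambda>t. \<Sum>r<n. indicator (E r) t) = ?\<phi> (\<Sum>r<n. \<tau> r)"
      using norm_sum_indicator[of "{..<n}" E] E E01 disj by simp
    finally show "?\<phi> (\<Sum>r<n. \<tau> r) \<le> K * c * ?\<phi> (\<Sum>r<n. \<sigma> r)" using K by simp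
  qed (use fundamental_function_pos fundamental_function_mono fundamental_function_subadd pos
    weight_seq_antimono[OF w] sum_weight_seq_le_1[OF w] in auto)
  then show ?thesis by (rule that)
qed

end

theorem corollary3p6:
  fixes w :: "real \<Rightarrow> real"
    and X :: "(real \<Rightarrow> real) set"
    and N :: "(real \<Rightarrow> real) \<Rightarrow> real"
  defines "\<phi> \<equiv> fundamental_function N"
  assumes "nontrivial_weight w"
    and "symmetric_space X N"
    and "decomposable w X N"
  shows "\<exists>C::real. C > 0 \<and> (\<exists>p::ereal. 1 \<le> p \<and>
           (\<forall>\<tau>::nat \<Rightarrow> real. (\<forall>r. 0 < \<tau> r \<and> \<tau> r \<le> weight_seq w r) \<longrightarrow>
              ereal (inverse C * \<phi> (\<Sum>r. \<tau> r)) \<le> lp_norm p (\<lambda>r. \<phi> (\<tau> r)) \<and>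
              lp_norm p (\<lambda>r. \<phi> (\<tau> r)) \<le> ereal (C * \<phi> (\<Sum>r. \<tau> r))))"
proof (cases "\<forall>r. 0 < weight_seq w r")
  case True
  interpret symmetric_space X N by fact
  have w: "w \<in> borel_measurable leb01"
    using \<open>nontrivial_weight w\<close> by (simp add: nontrivial_weight_def weight_def)
  obtain K where "level_comparable (fundamental_function N) (weight_seq w) K"
    using level_comparable_fundamental_function[OF w \<open>decomposable w X N\<close>] True by blast
  then show ?thesis unfolding \<phi>_def by (rule level_comparable.lp_norm_estimate)
next
  case False
  \<comment> \<open>If some term of \<open>weight_seq w\<close> is not positive, no sequence is
    admissible and the estimate holds vacuously.\<close>
  then have "\<not> (\<forall>r. 0 < \<tau> r \<and> \<tau> r \<le> weight_seq w r)" for \<tau> by (meson order_less_le_trans)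
  then show ?thesis by (intro exI[of _ 1] conjI) auto
qed

end
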